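(* Let $K \subseteq \mathbb{R}^d$ be a symmetric compact convex set (that is, $K=-K$) and let $H$ be a Hilbert space. If $A \in \mathcal{B}(H)^d_{sa}$ has $\mathcal{W}_1(A) \subseteq K$, then there exists a normal dilation $A \prec N$ with $\sigma(N) \subseteq d \cdot K$.
   Context: $\mathcal{B}(H)^d_{sa}$ denotes $d$-tuples of self-adjoint bounded operators on $H$. For a $d$-tuple $A$ of bounded operators, $\mathcal{W}_1(A)=\{(\varphi(A_1),\dots,\varphi(A_d)) : \varphi \text{ a state on the unital } C^*\text{-algebra generated by } A\}$. A tuple $N$ on $H_2$ is a dilation of a tuple $A$ on $H$ (written $A\prec N$) if there is an isometry $V:H\to H_2$ with $A_i=V^*N_iV$ for all $i$. A normal tuple is a tuple of commuting normal bounded operators (on some Hilbert space); $\sigma(N)$ is its joint spectrum; a normal dilation is a dilation that is a normal tuple. *)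

theory Defs
  imports "HOL-Analysis.Analysis" "HOL-Algebra.Algebraic_Closure_Type"
begin

section \<open>Complex Hilbert spaces with explicit carrier\<close>

text \<open>Hilbert spaces are structures rather than instances of a type class, so that a statement can
  quantify existentially over them. Such a quantifier has to fix the type containing the carrier. For
  the dilation space of a tuple on \<open>H\<close>, with carrier in \<open>'a\<close>, the type \<open>nat \<Rightarrow> 'a\<close> is no restriction:
  cutting a normal dilation \<open>N\<close> down to the closed reducing subspace generated by the image of \<open>H\<close>
  leaves a normal dilation, with no larger joint spectrum, on a space with at most as many elements
  as there are sequences in \<open>H\<close>. The ring multiplication and the unit which the record
  inherits play no role. The inner product is linear in its first argument.\<close>

record 'a hilbert = "(complex, 'a) module" +
  inner_prod :: "'a \<Rightarrow> 'a \<Rightarrow> complex"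

definition hnorm :: "('a, 'b) hilbert_scheme \<Rightarrow> 'a \<Rightarrow> real" where
  "hnorm H x = sqrt (Re (inner_prod H x x))"

locale hilbert_space = module "ring_of_type_algebra :: complex ring" H
  for H :: "('a, 'b) hilbert_scheme" (structure) +
  assumes inner_prod_add_left:
      "\<lbrakk>x \<in> carrier H; y \<in> carrier H; z \<in> carrier H\<rbrakk> \<Longrightarrow>
        inner_prod H (x \<oplus> y) z = inner_prod H x z + inner_prod H y z"
    and inner_prod_smult_left:
      "\<lbrakk>x \<in> carrier H; y \<in> carrier H\<rbrakk> \<Longrightarrow> inner_prod H (c \<odot> x) y = c * inner_prod H x y"
    and inner_prod_commute:
      "\<lbrakk>x \<in> carrier H; y \<in> carrier H\<rbrakk> \<Longrightarrow> inner_prod H y x = cnj (inner_prod H x y)"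
    and inner_prod_nonneg: "x \<in> carrier H \<Longrightarrow> inner_prod H x x \<in> \<real>\<^sub>\<ge>\<^sub>0"
    and inner_prod_definite: "\<lbrakk>x \<in> carrier H; inner_prod H x x = 0\<rbrakk> \<Longrightarrow> x = \<zero>"
    and complete:
      "\<lbrakk>\<And>n. f n \<in> carrier H;
        \<And>e. e > 0 \<Longrightarrow> \<exists>M::nat. \<forall>m\<ge>M. \<forall>n\<ge>M. hnorm H (f m \<ominus> f n) < e\<rbrakk> \<Longrightarrow>
        \<exists>x\<in>carrier H. (\<lambda>n. hnorm H (f n \<ominus> x)) \<longlonglongrightarrow> 0"


section \<open>Bounded operators\<close>

text \<open>Operators are extensional functions on the carrier, so that equality of operators is equality
  of functions, and composition is \<^const>\<open>compose\<close>.\<close>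

definition bounded_op :: "('a, 'c) hilbert_scheme \<Rightarrow> ('b, 'd) hilbert_scheme \<Rightarrow> ('a \<Rightarrow> 'b) set" where
  "bounded_op H G = {T \<in> carrier H \<rightarrow>\<^sub>E carrier G.
     (\<forall>x\<in>carrier H. \<forall>y\<in>carrier H. T (x \<oplus>\<^bsub>H\<^esub> y) = T x \<oplus>\<^bsub>G\<^esub> T y) \<and>
     (\<forall>c. \<forall>x\<in>carrier H. T (c \<odot>\<^bsub>H\<^esub> x) = c \<odot>\<^bsub>G\<^esub> T x) \<and>
     (\<exists>b. \<forall>x\<in>carrier H. hnorm G (T x) \<le> b * hnorm H x)}"

definition adjoint_op ::
  "('a, 'c) hilbert_scheme \<Rightarrow> ('b, 'd) hilbert_scheme \<Rightarrow> ('a \<Rightarrow> 'b) \<Rightarrow> ('b \<Rightarrow> 'a)" where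
  "adjoint_op H G T = (THE S. S \<in> bounded_op G H \<and>
     (\<forall>x\<in>carrier H. \<forall>y\<in>carrier G. inner_prod G (T x) y = inner_prod H x (S y)))"

definition isometry_op :: "('a, 'c) hilbert_scheme \<Rightarrow> ('b, 'd) hilbert_scheme \<Rightarrow> ('a \<Rightarrow> 'b) set" where
  "isometry_op H G = {V \<in> bounded_op H G. \<forall>x\<in>carrier H. hnorm G (V x) = hnorm H x}"

definition op_norm :: "('a, 'c) hilbert_scheme \<Rightarrow> ('a \<Rightarrow> 'a) \<Rightarrow> real" where
  "op_norm H T = Sup {hnorm H (T x) | x. x \<in> carrier H \<and> hnorm H x \<le> 1}"

definition op_id :: "('a, 'c) hilbert_scheme \<Rightarrow> ('a \<Rightarrow> 'a)" where
  "op_id H = (\<lambda>x\<in>carrier H. x)"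

definition op_add :: "('a, 'c) hilbert_scheme \<Rightarrow> ('a \<Rightarrow> 'a) \<Rightarrow> ('a \<Rightarrow> 'a) \<Rightarrow> ('a \<Rightarrow> 'a)" where
  "op_add H S T = (\<lambda>x\<in>carrier H. S x \<oplus>\<^bsub>H\<^esub> T x)"

definition op_diff :: "('a, 'c) hilbert_scheme \<Rightarrow> ('a \<Rightarrow> 'a) \<Rightarrow> ('a \<Rightarrow> 'a) \<Rightarrow> ('a \<Rightarrow> 'a)" where
  "op_diff H S T = (\<lambda>x\<in>carrier H. S x \<ominus>\<^bsub>H\<^esub> T x)"

definition op_scale :: "('a, 'c) hilbert_scheme \<Rightarrow> complex \<Rightarrow> ('a \<Rightarrow> 'a) \<Rightarrow> ('a \<Rightarrow> 'a)" where
  "op_scale H c T = (\<lambda>x\<in>carrier H. c \<odot>\<^bsub>H\<^esub> T x)"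

definition op_comp :: "('a, 'c) hilbert_scheme \<Rightarrow> ('a \<Rightarrow> 'a) \<Rightarrow> ('a \<Rightarrow> 'a) \<Rightarrow> ('a \<Rightarrow> 'a)" where
  "op_comp H S T = compose (carrier H) S T"

definition selfadjoint_op :: "('a, 'c) hilbert_scheme \<Rightarrow> ('a \<Rightarrow> 'a) \<Rightarrow> bool" where
  "selfadjoint_op H T \<longleftrightarrow> T \<in> bounded_op H H \<and> adjoint_op H H T = T"

definition normal_op :: "('a, 'c) hilbert_scheme \<Rightarrow> ('a \<Rightarrow> 'a) \<Rightarrow> bool" where
  "normal_op H T \<longleftrightarrow> T \<in> bounded_op H H \<and>
     op_comp H (adjoint_op H H T) T = op_comp H T (adjoint_op H H T)"


section \<open>Operator tuples, states and characters\<close>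

definition unital_cstar_subalgebra :: "('a, 'c) hilbert_scheme \<Rightarrow> ('a \<Rightarrow> 'a) set \<Rightarrow> bool" where
  "unital_cstar_subalgebra H \<A> \<longleftrightarrow>
     \<A> \<subseteq> bounded_op H H \<and> op_id H \<in> \<A> \<and>
     (\<forall>S\<in>\<A>. \<forall>T\<in>\<A>. op_add H S T \<in> \<A> \<and> op_comp H S T \<in> \<A>) \<and>
     (\<forall>c. \<forall>T\<in>\<A>. op_scale H c T \<in> \<A>) \<and>
     (\<forall>T\<in>\<A>. adjoint_op H H T \<in> \<A>) \<and>
     (\<forall>F T. (\<forall>n::nat. F n \<in> \<A>) \<and> T \<in> bounded_op H H \<and>
        (\<lambda>n. op_norm H (op_diff H (F n) T)) \<longlonglongrightarrow> 0 \<longrightarrow> T \<in> \<A>)"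

definition cstar_generated :: "('a, 'c) hilbert_scheme \<Rightarrow> ('i \<Rightarrow> 'a \<Rightarrow> 'a) \<Rightarrow> ('a \<Rightarrow> 'a) set" where
  "cstar_generated H A = unital_cstar_subalgebra H hull range A"

definition linear_functional_on ::
  "('a, 'c) hilbert_scheme \<Rightarrow> ('a \<Rightarrow> 'a) set \<Rightarrow> (('a \<Rightarrow> 'a) \<Rightarrow> complex) \<Rightarrow> bool" where
  "linear_functional_on H \<A> \<phi> \<longleftrightarrow>
     (\<forall>S\<in>\<A>. \<forall>T\<in>\<A>. \<phi> (op_add H S T) = \<phi> S + \<phi> T) \<and>
     (\<forall>c. \<forall>T\<in>\<A>. \<phi> (op_scale H c T) = c * \<phi> T)"

definition state_on ::
  "('a, 'c) hilbert_scheme \<Rightarrow> ('a \<Rightarrow> 'a) set \<Rightarrow> (('a \<Rightarrow> 'a) \<Rightarrow> complex) \<Rightarrow> bool" where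
  "state_on H \<A> \<phi> \<longleftrightarrow> linear_functional_on H \<A> \<phi> \<and>
     (\<forall>T\<in>\<A>. \<phi> (op_comp H (adjoint_op H H T) T) \<in> \<real>\<^sub>\<ge>\<^sub>0) \<and> \<phi> (op_id H) = 1"

definition character_on ::
  "('a, 'c) hilbert_scheme \<Rightarrow> ('a \<Rightarrow> 'a) set \<Rightarrow> (('a \<Rightarrow> 'a) \<Rightarrow> complex) \<Rightarrow> bool" where
  "character_on H \<A> \<phi> \<longleftrightarrow> linear_functional_on H \<A> \<phi> \<and>
     (\<forall>S\<in>\<A>. \<forall>T\<in>\<A>. \<phi> (op_comp H S T) = \<phi> S * \<phi> T) \<and> (\<exists>T\<in>\<A>. \<phi> T \<noteq> 0)"

definition W1 :: "('a, 'c) hilbert_scheme \<Rightarrow> ('d::finite \<Rightarrow> 'a \<Rightarrow> 'a) \<Rightarrow> (complex ^ 'd) set" where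
  "W1 H A = {(\<chi> i. \<phi> (A i)) | \<phi>. state_on H (cstar_generated H A) \<phi>}"

definition normal_tuple :: "('a, 'c) hilbert_scheme \<Rightarrow> ('d::finite \<Rightarrow> 'a \<Rightarrow> 'a) \<Rightarrow> bool" where
  "normal_tuple H N \<longleftrightarrow> (\<forall>i. normal_op H (N i)) \<and>
     (\<forall>i j. op_comp H (N i) (N j) = op_comp H (N j) (N i))"

text \<open>The joint spectrum of a normal tuple, as the image of the Gelfand spectrum of the commutative
  unital \<open>C\<^sup>*\<close>-algebra generated by the tuple.\<close>

definition joint_spectrum ::
  "('a, 'c) hilbert_scheme \<Rightarrow> ('d::finite \<Rightarrow> 'a \<Rightarrow> 'a) \<Rightarrow> (complex ^ 'd) set" where
  "joint_spectrum H N = {(\<chi> i. \<phi> (N i)) | \<phi>. character_on H (cstar_generated H N) \<phi>}"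

definition is_dilation :: "('a, 'c) hilbert_scheme \<Rightarrow> ('d::finite \<Rightarrow> 'a \<Rightarrow> 'a) \<Rightarrow>
    ('b, 'e) hilbert_scheme \<Rightarrow> ('d \<Rightarrow> 'b \<Rightarrow> 'b) \<Rightarrow> bool" where
  "is_dilation H A H2 N \<longleftrightarrow> (\<exists>V\<in>isometry_op H H2. \<forall>i.
     A i = compose (carrier H) (adjoint_op H H2 V) (compose (carrier H) (N i) V))"

text \<open>The inclusion of \<open>\<real>\<^sup>d\<close> into \<open>\<complex>\<^sup>d\<close>, needed because states and characters are complex valued.\<close>

definition complex_vec :: "real ^ 'd \<Rightarrow> complex ^ 'd::finite" where
  "complex_vec x = (\<chi> i. complex_of_real (x $ i))"

end

theory Submission
  imports Defs
begin

text \<open>An Auerbach basis of \<open>K\<close> consists of points \<open>e\<^sub>i \<in> K\<close> and functionals \<open>f\<^sub>i\<close> with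
  \<open>\<bar>f\<^sub>i\<bar> \<le> 1\<close> on \<open>K\<close> and \<open>x = \<Sum>\<^sub>i f\<^sub>i(x) e\<^sub>i\<close> for \<open>x \<in> K\<close>. Applied to the numerical
  range of \<open>A\<close>, this gives \<open>A = \<Sum>\<^sub>i e\<^sub>i \<otimes> F\<^sub>i\<close> with the self-adjoint contractions \<open>F\<^sub>i = f\<^sub>i(A)\<close>.
  Hence \<open>A\<close> is the average of the \<open>d\<close> tuples \<open>d e\<^sub>i \<otimes> F\<^sub>i\<close>. Each of them commutes and has joint
  spectrum in \<open>[-1, 1] d e\<^sub>i \<subseteq> d K\<close>, and their average is the compression of their direct sum to
  the diagonal copy of \<open>H\<close> in \<open>H\<^sup>d\<close>.\<close>

section \<open>Hilbert spaces\<close>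

text \<open>The constant \<open>d\<close> is the number of summands: the isometry onto the diagonal
  carries the factor 1 / sqrt d, so a compressed direct sum is the mean of its blocks, and the
  blocks need an extra factor \<open>d\<close> to make that mean equal to \<open>A\<close>. The
  hypothesis on \<open>W1\<close> only controls quadratic forms of unit vectors. Two facts about
  self-adjoint operators turn this into operator statements: the numerical radius bounds the norm,
  which makes the \<open>F i\<close> contractions, and (the case of bound 0) the form determines the
  operator, which gives the decomposition of \<open>A\<close>. Characters are defined purely
  algebraically, so that they are contractive, and real on self-adjoint elements, has to be derived
  from norm-closedness of the algebra. The spectrum of the direct sum is not split into the spectra
  of its blocks. A character sends g . N to a number of modulus at most the maximum of |d g . e_i|,
  so a spectral point satisfies every linear inequality that defines the absolutely convex hull of
  the points d e_i; a separation argument then places it in d K.\<close>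

lemma ring_of_type_algebra_simps [simp]:
  "carrier ring_of_type_algebra = UNIV"
  "x \<oplus>\<^bsub>ring_of_type_algebra\<^esub> y = x + y"
  "x \<otimes>\<^bsub>ring_of_type_algebra\<^esub> y = x * y"
  "\<one>\<^bsub>ring_of_type_algebra\<^esub> = 1"
  "\<zero>\<^bsub>ring_of_type_algebra\<^esub> = 0"
  by (simp_all add: ring_of_type_algebra_def)

lemma mult_cnj_cmod: "z * cnj z = (complex_of_real (cmod z))\<^sup>2"
  by (simp only: of_real_power[symmetric] complex_norm_square)

section \<open>Inner product and norm calculus\<close>

context hilbert_space
begin

lemma scale_closed [simp, intro]: "x \<in> carrier H \<Longrightarrow> c \<odot> x \<in> carrier H"
  by (rule smult_closed) simp_all

lemma inner_prod_add_right:
  assumes "x \<in> carrier H" "y \<in> carrier H" "z \<in> carrier H"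
  shows "inner_prod H x (y \<oplus> z) = inner_prod H x y + inner_prod H x z"
  using assms inner_prod_commute[of "y \<oplus> z" x] inner_prod_commute[of y x] inner_prod_commute[of z x]
  by (simp add: inner_prod_add_left)

lemma inner_prod_smult_right:
  assumes "x \<in> carrier H" "y \<in> carrier H"
  shows "inner_prod H x (c \<odot> y) = cnj c * inner_prod H x y"
  using assms inner_prod_commute[of "c \<odot> y" x] inner_prod_commute[of y x]
  by (simp add: inner_prod_smult_left)

lemma scale_zero [simp]: "x \<in> carrier H \<Longrightarrow> 0 \<odot> x = \<zero>"
  using smult_l_null[of x] by simp

lemma minus_eq_scale: "x \<in> carrier H \<Longrightarrow> \<ominus> x = (-1) \<odot> x"
  using smult_l_distr[of 1 "-1" x] smult_one[of x] smult_l_null[of x]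
  by (intro M.minus_equality) (simp_all add: M.add.m_comm)

lemma inner_prod_zero_left [simp]: "y \<in> carrier H \<Longrightarrow> inner_prod H \<zero> y = 0"
  using inner_prod_smult_left[of \<zero> y 0] by simp

lemma inner_prod_zero_right [simp]: "y \<in> carrier H \<Longrightarrow> inner_prod H y \<zero> = 0"
  using inner_prod_smult_right[of y \<zero> 0] by simp

lemma inner_prod_diff_left:
  assumes "x \<in> carrier H" "y \<in> carrier H" "z \<in> carrier H"
  shows "inner_prod H (x \<ominus> y) z = inner_prod H x z - inner_prod H y z"
  using assms by (simp add: a_minus_def minus_eq_scale inner_prod_add_left inner_prod_smult_left)

lemma inner_prod_diff_right:
  assumes "x \<in> carrier H" "y \<in> carrier H" "z \<in> carrier H"
  shows "inner_prod H x (y \<ominus> z) = inner_prod H x y - inner_prod H x z"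
  using assms by (simp add: a_minus_def minus_eq_scale inner_prod_add_right inner_prod_smult_right)

lemmas inner_prod_simps = inner_prod_add_left inner_prod_add_right inner_prod_smult_left
  inner_prod_smult_right inner_prod_diff_left inner_prod_diff_right

lemma inner_prod_finsum_left:
  assumes "finite J" "f \<in> J \<rightarrow> carrier H" "z \<in> carrier H"
  shows "inner_prod H (\<Oplus>j\<in>J. f j) z = (\<Sum>j\<in>J. inner_prod H (f j) z)"
  using assms
proof (induction J rule: finite_induct)
  case empty
  then show ?case by simp
next
  case (insert a J)
  then have "f \<in> J \<rightarrow> carrier H" "f a \<in> carrier H" by auto
  with insert show ?case by (simp add: inner_prod_add_left)
qed

lemma eq_if_diff_zero:
  assumes "x \<in> carrier H" "y \<in> carrier H" "x \<ominus> y = \<zero>"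
  shows "x = y"
  using assms M.minus_equality[of x "\<ominus> y"] by (simp add: a_minus_def)

text \<open>By definiteness, tested on the difference \<open>x \<ominus> y\<close>. Most vector
  identities below are reduced through this rule to arithmetic with complex numbers.\<close>

lemma inner_prod_ext:
  assumes "x \<in> carrier H" "y \<in> carrier H"
    and "\<And>z. z \<in> carrier H \<Longrightarrow> inner_prod H x z = inner_prod H y z"
  shows "x = y"
proof (rule eq_if_diff_zero[OF assms(1,2)], rule inner_prod_definite)
  show "inner_prod H (x \<ominus> y) (x \<ominus> y) = 0"
    using assms by (simp add: inner_prod_diff_left)
qed (simp add: assms)

lemma hnorm_nonneg [simp]: "hnorm H x \<ge> 0"
  if "x \<in> carrier H"
  using inner_prod_nonneg[OF that] by (simp add: hnorm_def complex_nonneg_Reals_iff)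

lemma hnorm_sq: "x \<in> carrier H \<Longrightarrow> (hnorm H x)\<^sup>2 = Re (inner_prod H x x)"
  using inner_prod_nonneg[of x] by (simp add: hnorm_def complex_nonneg_Reals_iff)

lemma inner_prod_self: "x \<in> carrier H \<Longrightarrow> inner_prod H x x = complex_of_real ((hnorm H x)\<^sup>2)"
  using inner_prod_nonneg[of x] by (simp add: hnorm_sq complex_eq_iff complex_nonneg_Reals_iff)

lemma hnorm_eq_0_iff: "x \<in> carrier H \<Longrightarrow> hnorm H x = 0 \<longleftrightarrow> x = \<zero>"
  by (metis inner_prod_definite inner_prod_self inner_prod_zero_left of_real_0 of_real_eq_iff
      power_zero_numeral zero_eq_power2)

lemma hnorm_zero [simp]: "hnorm H \<zero> = 0"
  by (simp add: hnorm_eq_0_iff)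

lemma hnorm_scale: "x \<in> carrier H \<Longrightarrow> hnorm H (c \<odot> x) = cmod c * hnorm H x"
proof -
  assume x: "x \<in> carrier H"
  have "inner_prod H (c \<odot> x) (c \<odot> x) = complex_of_real ((cmod c * hnorm H x)\<^sup>2)"
    using x by (simp add: inner_prod_simps inner_prod_self[OF x] power_mult_distrib
      mult_cnj_cmod[symmetric] mult_ac)
  then have "(hnorm H (c \<odot> x))\<^sup>2 = (cmod c * hnorm H x)\<^sup>2"
    using x by (simp add: hnorm_sq del: of_real_power)
  then show ?thesis using x by (simp add: power2_eq_iff_nonneg)
qed

lemma hnorm_add_sq:
  assumes "x \<in> carrier H" "y \<in> carrier H"
  shows "(hnorm H (x \<oplus> y))\<^sup>2 = (hnorm H x)\<^sup>2 + (hnorm H y)\<^sup>2 + 2 * Re (inner_prod H x y)"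
  using assms inner_prod_commute[of x y] by (simp add: hnorm_sq inner_prod_simps)

lemma hnorm_diff_sq:
  assumes "x \<in> carrier H" "y \<in> carrier H"
  shows "(hnorm H (x \<ominus> y))\<^sup>2 = (hnorm H x)\<^sup>2 + (hnorm H y)\<^sup>2 - 2 * Re (inner_prod H x y)"
  using assms inner_prod_commute[of x y] by (simp add: hnorm_sq inner_prod_simps)

lemma hnorm_minus_commute:
  assumes "x \<in> carrier H" "y \<in> carrier H"
  shows "hnorm H (x \<ominus> y) = hnorm H (y \<ominus> x)"
proof -
  have "(hnorm H (x \<ominus> y))\<^sup>2 = (hnorm H (y \<ominus> x))\<^sup>2"
    using assms inner_prod_commute[of x y] by (simp add: hnorm_diff_sq)
  then show ?thesis using assms by (simp add: power2_eq_iff_nonneg)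
qed

lemma cauchy_schwarz:
  assumes "x \<in> carrier H" "y \<in> carrier H"
  shows "cmod (inner_prod H x y) \<le> hnorm H x * hnorm H y"
proof -
  let ?a = "inner_prod H x y"
  have *: "(hnorm H x)\<^sup>2 - 2 * t * (cmod ?a)\<^sup>2 + t\<^sup>2 * (cmod ?a)\<^sup>2 * (hnorm H y)\<^sup>2 \<ge> 0" for t :: real
  proof -
    \<comment> \<open>The phase of the inner product is absorbed into the scalar, so that the
      expansion of the squared norm of x - c y is a real quadratic in \<open>t\<close>; its minimum
      is at t = 1 / |y|^2, the value used below.\<close>
    let ?c = "complex_of_real t * ?a"
    have "inner_prod H x (?c \<odot> y) = complex_of_real (t * (cmod ?a)\<^sup>2)"
      using assms by (simp add: inner_prod_simps mult_cnj_cmod mult_ac)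
    then have "Re (inner_prod H x (?c \<odot> y)) = t * (cmod ?a)\<^sup>2"
      by (metis Re_complex_of_real)
    moreover have "(hnorm H (?c \<odot> y))\<^sup>2 = t\<^sup>2 * (cmod ?a)\<^sup>2 * (hnorm H y)\<^sup>2"
      using assms by (simp add: hnorm_scale norm_mult power_mult_distrib)
    ultimately show ?thesis
      using assms hnorm_diff_sq[of x "?c \<odot> y"] zero_le_power2[of "hnorm H (x \<ominus> ?c \<odot> y)"] by simp
  qed
  have "(cmod ?a)\<^sup>2 \<le> (hnorm H x)\<^sup>2 * (hnorm H y)\<^sup>2"
  proof (cases "hnorm H y = 0")
    case True
    then show ?thesis using assms by (simp add: hnorm_eq_0_iff)
  next
    case False
    then have "(hnorm H x)\<^sup>2 - (cmod ?a)\<^sup>2 / (hnorm H y)\<^sup>2 \<ge> 0"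
      using *[of "1 / (hnorm H y)\<^sup>2"] by (simp add: power2_eq_square)
    then show ?thesis using False by (simp add: pos_divide_le_eq)
  qed
  then show ?thesis
    using assms by (metis hnorm_nonneg mult_nonneg_nonneg power2_le_imp_le power_mult_distrib)
qed

lemma hnorm_triangle:
  assumes "x \<in> carrier H" "y \<in> carrier H"
  shows "hnorm H (x \<oplus> y) \<le> hnorm H x + hnorm H y"
proof -
  have "Re (inner_prod H x y) \<le> hnorm H x * hnorm H y"
    by (rule order_trans[OF complex_Re_le_cmod cauchy_schwarz[OF assms]])
  then have "(hnorm H (x \<oplus> y))\<^sup>2 \<le> (hnorm H x + hnorm H y)\<^sup>2"
    using assms by (simp add: hnorm_add_sq power2_sum)
  then show ?thesis using assms by (metis M.a_closed add_nonneg_nonneg hnorm_nonneg power2_le_imp_le)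
qed

lemma hnorm_diff_le:
  assumes "x \<in> carrier H" "y \<in> carrier H"
  shows "hnorm H (x \<ominus> y) \<le> hnorm H x + hnorm H y"
  using assms hnorm_triangle[of x "(-1) \<odot> y"] by (simp add: a_minus_def minus_eq_scale hnorm_scale)

lemma hnorm_diff_triangle:
  assumes "x \<in> carrier H" "y \<in> carrier H" "z \<in> carrier H"
  shows "hnorm H (x \<ominus> z) \<le> hnorm H (x \<ominus> y) + hnorm H (y \<ominus> z)"
proof -
  have "x \<ominus> z = (x \<ominus> y) \<oplus> (y \<ominus> z)"
    by (rule inner_prod_ext) (simp_all add: assms inner_prod_simps)
  then show ?thesis using assms by (simp add: hnorm_triangle)
qed

lemma hnorm_diff_ineq:
  assumes "x \<in> carrier H" "y \<in> carrier H"
  shows "\<bar>hnorm H x - hnorm H y\<bar> \<le> hnorm H (x \<ominus> y)"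
proof -
  have "hnorm H x \<le> hnorm H y + hnorm H (x \<ominus> y)" if "x \<in> carrier H" "y \<in> carrier H" for x y
  proof -
    have "x = y \<oplus> (x \<ominus> y)"
      by (rule inner_prod_ext) (simp_all add: that inner_prod_simps)
    then show ?thesis using that hnorm_triangle[of y "x \<ominus> y"] by simp
  qed
  from this[of x y] this[of y x] show ?thesis using assms by (simp add: hnorm_minus_commute)
qed

lemma tendsto_inner_prod:
  assumes "\<And>n. f n \<in> carrier H" "x \<in> carrier H" "y \<in> carrier H"
    and "(\<lambda>n. hnorm H (f n \<ominus> x)) \<longlonglongrightarrow> 0"
  shows "(\<lambda>n. inner_prod H (f n) y) \<longlonglongrightarrow> inner_prod H x y"
proof (rule LIM_zero_cancel, rule Lim_null_comparison)
  show "\<forall>\<^sub>F n in sequentially. cmod (inner_prod H (f n) y - inner_prod H x y)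
      \<le> hnorm H (f n \<ominus> x) * hnorm H y"
    using assms cauchy_schwarz by (intro always_eventually allI) (simp flip: inner_prod_diff_left)
  show "(\<lambda>n. hnorm H (f n \<ominus> x) * hnorm H y) \<longlonglongrightarrow> 0"
    using tendsto_mult_right[OF assms(4), of "hnorm H y"] by simp
qed

lemma tendsto_hnorm:
  assumes "\<And>n. f n \<in> carrier H" "x \<in> carrier H"
    and "(\<lambda>n. hnorm H (f n \<ominus> x)) \<longlonglongrightarrow> 0"
  shows "(\<lambda>n. hnorm H (f n)) \<longlonglongrightarrow> hnorm H x"
  using assms hnorm_diff_ineq
  by (intro LIM_zero_cancel[OF Lim_null_comparison[OF always_eventually assms(3)]]) simp

end

section \<open>Riesz representation of bounded functionals\<close>

context hilbert_space
begin

text \<open>If f = <., z>, then |x|^2 - 2 Re (f x) = |x - z|^2 - |z|^2, so \<open>z\<close> has to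
  be the minimiser of \<open>q\<close>. Conversely, \<open>q\<close> is bounded below, a minimising
  sequence converges by completeness, and the vanishing derivative at the minimiser is the
  claim.\<close>

lemma riesz_representation:
  assumes add: "\<And>x y. x \<in> carrier H \<Longrightarrow> y \<in> carrier H \<Longrightarrow> f (x \<oplus> y) = f x + f y"
    and scale: "\<And>c x. x \<in> carrier H \<Longrightarrow> f (c \<odot> x) = c * f x"
    and bound: "\<And>x. x \<in> carrier H \<Longrightarrow> cmod (f x) \<le> b * hnorm H x"
  shows "\<exists>z\<in>carrier H. \<forall>x\<in>carrier H. f x = inner_prod H x z"
proof -
  define q where "q x = (hnorm H x)\<^sup>2 - 2 * Re (f x)" for x
  have diff: "f (x \<ominus> y) = f x - f y" if "x \<in> carrier H" "y \<in> carrier H" for x y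
    using that add[of x "(-1) \<odot> y"] scale[of y "-1"] by (simp add: a_minus_def minus_eq_scale)
  have lower: "q x \<ge> - b\<^sup>2" if "x \<in> carrier H" for x
  proof -
    have "Re (f x) \<le> b * hnorm H x"
      using bound[OF that] complex_Re_le_cmod[of "f x"] by linarith
    moreover have "(hnorm H x - b)\<^sup>2 \<ge> 0" by simp
    ultimately show ?thesis by (simp add: q_def power2_diff mult.commute)
  qed
  define m where "m = Inf (q ` carrier H)"
  have bdd: "bdd_below (q ` carrier H)" using lower by (auto intro!: bdd_belowI[of _ "- b\<^sup>2"])
  have m_le: "m \<le> q x" if "x \<in> carrier H" for x
    unfolding m_def using bdd that by (intro cINF_lower)
  have "\<exists>x\<in>carrier H. q x < m + 1 / Suc n" for n
  proof -
    have "q ` carrier H \<noteq> {}" using M.zero_closed by blast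
    moreover have "Inf (q ` carrier H) < m + 1 / Suc n" by (simp add: m_def)
    ultimately have "\<exists>y\<in>q ` carrier H. y < m + 1 / Suc n" by (rule cInf_lessD)
    then show ?thesis by auto
  qed
  then obtain u where u: "\<And>n. u n \<in> carrier H" "\<And>n. q (u n) < m + 1 / Suc n" by metis
  \<comment> \<open>The real-linear part of \<open>q\<close> cancels at the midpoint, so this is the
    parallelogram law. Since \<open>q\<close> is at least \<open>m\<close> at the midpoint, almost
    minimal points are close to each other.\<close>
  have parallelogram: "(hnorm H (x \<ominus> y))\<^sup>2 = 2 * q x + 2 * q y - 4 * q (complex_of_real (1/2) \<odot> (x \<oplus> y))"
    if "x \<in> carrier H" "y \<in> carrier H" for x y
    using that by (simp add: q_def scale add hnorm_scale hnorm_diff_sq power_mult_distrib hnorm_add_sq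
        power_divide field_simps)
  have close: "(hnorm H (u k \<ominus> u n))\<^sup>2 \<le> 2 / Suc k + 2 / Suc n" for k n
    using parallelogram[OF u(1)[of k] u(1)[of n]] u(2)[of k] u(2)[of n]
      m_le[of "complex_of_real (1/2) \<odot> (u k \<oplus> u n)"] u(1) by simp
  have "\<exists>M. \<forall>k\<ge>M. \<forall>n\<ge>M. hnorm H (u k \<ominus> u n) < e" if "e > 0" for e
  proof -
    obtain M :: nat where M: "4 / e\<^sup>2 < M" using reals_Archimedean2 by blast
    have "hnorm H (u k \<ominus> u n) < e" if "k \<ge> M" "n \<ge> M" for k n
    proof -
      have "0 < real M" using M \<open>e > 0\<close> by (smt (verit) divide_nonneg_pos zero_less_power)
      have "(hnorm H (u k \<ominus> u n))\<^sup>2 \<le> 2 / real M + 2 / real M"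
        using close[of k n] that \<open>0 < real M\<close>
        by (smt (verit) frac_le of_nat_Suc of_nat_mono)
      also have "\<dots> < e\<^sup>2"
        using M \<open>e > 0\<close> \<open>0 < real M\<close> by (simp add: field_simps)
      finally show ?thesis using \<open>e > 0\<close> by (rule power2_less_imp_less[OF _ less_imp_le])
    qed
    then show ?thesis by blast
  qed
  then obtain z where z: "z \<in> carrier H" "(\<lambda>n. hnorm H (u n \<ominus> z)) \<longlonglongrightarrow> 0"
    using complete[of u] u(1) by blast
  have "(\<lambda>n. f (u n)) \<longlonglongrightarrow> f z"
  proof (rule LIM_zero_cancel, rule Lim_null_comparison)
    show "\<forall>\<^sub>F n in sequentially. cmod (f (u n) - f z) \<le> b * hnorm H (u n \<ominus> z)"
      using bound u(1) z(1) by (simp flip: diff)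
    show "(\<lambda>n. b * hnorm H (u n \<ominus> z)) \<longlonglongrightarrow> 0"
      using tendsto_mult_left[OF z(2), of b] by simp
  qed
  then have "(\<lambda>n. q (u n)) \<longlonglongrightarrow> q z"
    unfolding q_def using tendsto_hnorm[OF u(1) z] by (intro tendsto_intros)
  moreover have "(\<lambda>n. m + 1 / Suc n) \<longlonglongrightarrow> m + 0"
    using LIMSEQ_inverse_real_of_nat by (intro tendsto_intros) (simp add: divide_inverse)
  ultimately have "q z \<le> m + 0"
    using u(2) by (intro LIMSEQ_le) (auto intro: less_imp_le)
  then have min: "q z \<le> q x" if "x \<in> carrier H" for x using m_le[OF that] by simp
  have "f x = inner_prod H x z" if x: "x \<in> carrier H" for x
  proof -
    define d where "d = inner_prod H x z - f x"
    \<comment> \<open>A step of length \<open>t\<close> in the descent direction -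
      \<open>cnj d\<close> changes \<open>q\<close> by t |d|^2 (t |x|^2 - 2). This is negative for t
      |x|^2 at most 1 unless d = 0; the summand 1 covers x = 0.\<close>
    define t where "t = 1 / ((hnorm H x)\<^sup>2 + 1)"
    have den: "(hnorm H x)\<^sup>2 + 1 > 0" by (simp add: add_nonneg_pos)
    then have t: "t > 0" "t * (hnorm H x)\<^sup>2 \<le> 1" by (simp_all add: t_def field_simps)
    define c where "c = - complex_of_real t * cnj d"
    have "q (z \<oplus> c \<odot> x) = q z + (cmod c)\<^sup>2 * (hnorm H x)\<^sup>2 + 2 * Re (c * d)"
    proof -
      have "Re (cnj c * inner_prod H z x) = Re (c * inner_prod H x z)"
        using inner_prod_commute[OF x z(1)] by simp
      then show ?thesis
        using x z(1) by (simp add: q_def d_def hnorm_add_sq hnorm_scale inner_prod_smult_right add scale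
            power_mult_distrib algebra_simps)
    qed
    moreover have "c * d = complex_of_real (- t * (cmod d)\<^sup>2)"
      using mult_cnj_cmod[of d] by (simp add: c_def mult_ac)
    moreover have "(cmod c)\<^sup>2 = t\<^sup>2 * (cmod d)\<^sup>2"
      by (simp add: c_def norm_mult power_mult_distrib)
    ultimately have "0 \<le> t\<^sup>2 * (cmod d)\<^sup>2 * (hnorm H x)\<^sup>2 - 2 * t * (cmod d)\<^sup>2"
      using min[of "z \<oplus> c \<odot> x"] x z(1) by simp
    also have "\<dots> = t * (cmod d)\<^sup>2 * (t * (hnorm H x)\<^sup>2 - 2)"
      by (simp add: power2_eq_square algebra_simps)
    finally have "t * (cmod d)\<^sup>2 \<le> 0"
      using t(2) by (simp add: zero_le_mult_iff)
    then have "d = 0" using t(1) by (simp add: mult_le_0_iff)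
    then show ?thesis by (simp add: d_def)
  qed
  then show ?thesis using z(1) by blast
qed

end

section \<open>Bounded operators between Hilbert spaces and their adjoints\<close>

lemma bounded_opI:
  assumes "\<And>x. x \<in> carrier H \<Longrightarrow> T x \<in> carrier G"
    and "\<And>x y. x \<in> carrier H \<Longrightarrow> y \<in> carrier H \<Longrightarrow> T (x \<oplus>\<^bsub>H\<^esub> y) = T x \<oplus>\<^bsub>G\<^esub> T y"
    and "\<And>c x. x \<in> carrier H \<Longrightarrow> T (c \<odot>\<^bsub>H\<^esub> x) = c \<odot>\<^bsub>G\<^esub> T x"
    and "\<And>x. x \<in> carrier H \<Longrightarrow> hnorm G (T x) \<le> b * hnorm H x"
    and "T \<in> extensional (carrier H)"
  shows "T \<in> bounded_op H G"
  unfolding bounded_op_def PiE_def using assms by blast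

lemma bounded_op_closed [simp, intro]:
  "T \<in> bounded_op H G \<Longrightarrow> x \<in> carrier H \<Longrightarrow> T x \<in> carrier G"
  by (auto simp: bounded_op_def)

lemma bounded_op_add:
  "T \<in> bounded_op H G \<Longrightarrow> x \<in> carrier H \<Longrightarrow> y \<in> carrier H \<Longrightarrow> T (x \<oplus>\<^bsub>H\<^esub> y) = T x \<oplus>\<^bsub>G\<^esub> T y"
  by (simp add: bounded_op_def)

lemma bounded_op_scale:
  "T \<in> bounded_op H G \<Longrightarrow> x \<in> carrier H \<Longrightarrow> T (c \<odot>\<^bsub>H\<^esub> x) = c \<odot>\<^bsub>G\<^esub> T x"
  by (simp add: bounded_op_def)

lemma bounded_op_eqI:
  assumes "S \<in> bounded_op H G" "T \<in> bounded_op H G" "\<And>x. x \<in> carrier H \<Longrightarrow> S x = T x"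
  shows "S = T"
proof (rule extensionalityI)
  show "S \<in> extensional (carrier H)" "T \<in> extensional (carrier H)"
    using assms(1,2) by (simp_all only: bounded_op_def PiE_def mem_Collect_eq Int_iff)
qed (rule assms(3))

lemma bounded_op_bound:
  assumes "hilbert_space H" "T \<in> bounded_op H G"
  obtains b where "b \<ge> 0" "\<And>x. x \<in> carrier H \<Longrightarrow> hnorm G (T x) \<le> b * hnorm H x"
proof -
  obtain b where b: "\<forall>x\<in>carrier H. hnorm G (T x) \<le> b * hnorm H x"
    using assms(2) unfolding bounded_op_def by blast
  have "hnorm G (T x) \<le> \<bar>b\<bar> * hnorm H x" if "x \<in> carrier H" for x
  proof -
    have "b * hnorm H x \<le> \<bar>b\<bar> * hnorm H x"
      using hilbert_space.hnorm_nonneg[OF assms(1) that] by (simp add: mult_right_mono)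
    with b that show ?thesis by force
  qed
  then show ?thesis using that[of "\<bar>b\<bar>"] by simp
qed

locale hilbert_space_pair = H: hilbert_space H + G: hilbert_space G
  for H :: "('a, 'c) hilbert_scheme" and G :: "('b, 'd) hilbert_scheme"
begin

lemma bounded_op_diff:
  assumes "T \<in> bounded_op H G" "x \<in> carrier H" "y \<in> carrier H"
  shows "T (x \<ominus>\<^bsub>H\<^esub> y) = T x \<ominus>\<^bsub>G\<^esub> T y"
  using assms
  by (simp add: a_minus_def H.minus_eq_scale G.minus_eq_scale bounded_op_add[of T H G]
      bounded_op_scale[of T H G] bounded_op_closed[of T H G])

text \<open>For each \<open>y\<close> the functional x |-> <T x, y> is bounded, and Riesz supplies S
  y. Linearity of \<open>S\<close> follows from testing against inner products, and its bound from
  |S y|^2 = <y, T (S y)>.\<close>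

lemma adjoint_exists:
  assumes T: "T \<in> bounded_op H G"
  shows "\<exists>S\<in>bounded_op G H. \<forall>x\<in>carrier H. \<forall>y\<in>carrier G. inner_prod G (T x) y = inner_prod H x (S y)"
proof -
  obtain b where b: "b \<ge> 0" "\<And>x. x \<in> carrier H \<Longrightarrow> hnorm G (T x) \<le> b * hnorm H x"
    using bounded_op_bound[OF H.hilbert_space_axioms T] by blast
  note T_simps = bounded_op_closed[OF T] bounded_op_add[OF T] bounded_op_scale[OF T]
  have "\<exists>z\<in>carrier H. \<forall>x\<in>carrier H. inner_prod G (T x) y = inner_prod H x z"
    if y: "y \<in> carrier G" for y
  proof (rule H.riesz_representation)
    fix x assume x: "x \<in> carrier H"
    have "cmod (inner_prod G (T x) y) \<le> hnorm G (T x) * hnorm G y"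
      using T x y by (intro G.cauchy_schwarz) auto
    also have "\<dots> \<le> (b * hnorm H x) * hnorm G y"
      using b(2)[OF x] y by (intro mult_right_mono) auto
    finally show "cmod (inner_prod G (T x) y) \<le> (b * hnorm G y) * hnorm H x" by (simp add: mult_ac)
  qed (use y in \<open>simp_all add: T_simps G.inner_prod_simps\<close>)
  then obtain S0 where S0: "\<And>y. y \<in> carrier G \<Longrightarrow> S0 y \<in> carrier H"
    "\<And>x y. x \<in> carrier H \<Longrightarrow> y \<in> carrier G \<Longrightarrow> inner_prod G (T x) y = inner_prod H x (S0 y)"
    by metis
  have adj: "inner_prod H (S0 y) x = inner_prod G y (T x)" if "x \<in> carrier H" "y \<in> carrier G" for x y
    using S0(2)[OF that] H.inner_prod_commute[of x "S0 y"] G.inner_prod_commute[of "T x" y] S0(1) that T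
    by auto
  define S where "S = restrict S0 (carrier G)"
  have "S \<in> bounded_op G H"
  proof (rule bounded_opI[where b = b])
    fix x y assume xy: "x \<in> carrier G" "y \<in> carrier G"
    show "S (x \<oplus>\<^bsub>G\<^esub> y) = S x \<oplus>\<^bsub>H\<^esub> S y"
      using xy by (intro H.inner_prod_ext) (simp_all add: S_def S0(1) H.inner_prod_simps adj G.inner_prod_simps T_simps)
  next
    fix c x assume x: "x \<in> carrier G"
    show "S (c \<odot>\<^bsub>G\<^esub> x) = c \<odot>\<^bsub>H\<^esub> S x"
      using x by (intro H.inner_prod_ext) (simp_all add: S_def S0(1) H.inner_prod_simps adj G.inner_prod_simps T_simps)
  next
    fix x assume x: "x \<in> carrier G"
    let ?n = "hnorm H (S0 x)"
    have "?n\<^sup>2 = Re (inner_prod G x (T (S0 x)))"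
      using x by (simp add: H.hnorm_sq S0(1) adj)
    also have "\<dots> \<le> hnorm G x * hnorm G (T (S0 x))"
      using x S0(1) T by (intro order_trans[OF complex_Re_le_cmod G.cauchy_schwarz]) auto
    also have "\<dots> \<le> hnorm G x * (b * ?n)"
      using x S0(1) b by (intro mult_left_mono) auto
    finally have "?n * ?n \<le> (b * hnorm G x) * ?n" by (simp add: power2_eq_square mult_ac)
    moreover have "?n \<ge> 0" "b * hnorm G x \<ge> 0" using x b(1) S0(1) by auto
    ultimately have "?n \<le> b * hnorm G x" by (metis less_eq_real_def mult_le_cancel_right)
    then show "hnorm H (S x) \<le> b * hnorm G x" using x by (simp add: S_def)
  qed (simp_all add: S_def S0(1))
  then show ?thesis using S0(2) by (intro bexI[of _ S]) (simp_all add: S_def)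
qed

text \<open>Uniqueness of the adjoint, which resolves the definite description in
  \<open>adjoint_op\<close>.\<close>

lemma adjoint_op_eqI:
  assumes "S \<in> bounded_op G H"
    and adj: "\<And>x y. x \<in> carrier H \<Longrightarrow> y \<in> carrier G \<Longrightarrow> inner_prod G (T x) y = inner_prod H x (S y)"
  shows "adjoint_op H G T = S"
  unfolding adjoint_op_def
proof (rule the_equality)
  fix S' assume S': "S' \<in> bounded_op G H \<and>
    (\<forall>x\<in>carrier H. \<forall>y\<in>carrier G. inner_prod G (T x) y = inner_prod H x (S' y))"
  show "S' = S"
  proof (rule bounded_op_eqI)
    fix y assume y: "y \<in> carrier G"
    have "inner_prod H (S' y) z = inner_prod H (S y) z" if z: "z \<in> carrier H" for z
      using S' adj[OF z y] y z assms(1) H.inner_prod_commute[of z "S' y"] H.inner_prod_commute[of z "S y"]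
      by (metis bounded_op_closed)
    then show "S' y = S y" using S' assms(1) y by (intro H.inner_prod_ext) auto
  qed (use S' assms(1) in auto)
qed (use assms in auto)

lemma adjoint_op_closed: "T \<in> bounded_op H G \<Longrightarrow> adjoint_op H G T \<in> bounded_op G H"
  using adjoint_exists[of T] adjoint_op_eqI[of _ T] by auto

lemma inner_prod_adjoint:
  assumes "T \<in> bounded_op H G" "x \<in> carrier H" "y \<in> carrier G"
  shows "inner_prod H x (adjoint_op H G T y) = inner_prod G (T x) y"
    and "inner_prod H (adjoint_op H G T y) x = inner_prod G y (T x)"
proof -
  obtain S where S: "S \<in> bounded_op G H"
    "\<And>x y. x \<in> carrier H \<Longrightarrow> y \<in> carrier G \<Longrightarrow> inner_prod G (T x) y = inner_prod H x (S y)"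
    using adjoint_exists[OF assms(1)] by blast
  then have "adjoint_op H G T = S" by (intro adjoint_op_eqI) auto
  then show 1: "inner_prod H x (adjoint_op H G T y) = inner_prod G (T x) y" using S assms by simp
  show "inner_prod H (adjoint_op H G T y) x = inner_prod G y (T x)"
    using 1 assms adjoint_op_closed[OF assms(1)] H.inner_prod_commute[of x "adjoint_op H G T y"]
      G.inner_prod_commute[of "T x" y] by (auto simp: bounded_op_closed)
qed

end

section \<open>Operator algebras, states and characters\<close>

context hilbert_space
begin

interpretation self: hilbert_space_pair H H
  by unfold_locales

lemma selfadjoint_op_iff:
  "selfadjoint_op H T \<longleftrightarrow> T \<in> bounded_op H H \<and>
    (\<forall>x\<in>carrier H. \<forall>y\<in>carrier H. inner_prod H (T x) y = inner_prod H x (T y))"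
proof
  assume "selfadjoint_op H T"
  then have T: "T \<in> bounded_op H H" "adjoint_op H H T = T" by (simp_all add: selfadjoint_op_def)
  then show "T \<in> bounded_op H H \<and>
    (\<forall>x\<in>carrier H. \<forall>y\<in>carrier H. inner_prod H (T x) y = inner_prod H x (T y))"
    using self.inner_prod_adjoint(1)[OF T(1)] by simp
next
  assume "T \<in> bounded_op H H \<and>
    (\<forall>x\<in>carrier H. \<forall>y\<in>carrier H. inner_prod H (T x) y = inner_prod H x (T y))"
  then show "selfadjoint_op H T"
    by (simp add: selfadjoint_op_def self.adjoint_op_eqI)
qed

lemma op_simps [simp]:
  assumes "x \<in> carrier H"
  shows "op_id H x = x" "op_add H S T x = S x \<oplus> T x" "op_diff H S T x = S x \<ominus> T x"
    "op_scale H c T x = c \<odot> T x" "op_comp H S T x = S (T x)"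
  using assms by (simp_all add: op_id_def op_add_def op_diff_def op_scale_def op_comp_def compose_def)

lemma op_id_bounded: "op_id H \<in> bounded_op H H"
  by (rule bounded_opI[where b = 1]) (simp_all add: op_id_def)

lemma op_scale_bounded:
  assumes T: "T \<in> bounded_op H H"
  shows "op_scale H c T \<in> bounded_op H H"
proof -
  obtain b where b: "\<And>x. x \<in> carrier H \<Longrightarrow> hnorm H (T x) \<le> b * hnorm H x"
    using bounded_op_bound[OF hilbert_space_axioms T] by metis
  show ?thesis
  proof (rule bounded_opI[where b = "cmod c * b"])
    fix x assume x: "x \<in> carrier H"
    then show "hnorm H (op_scale H c T x) \<le> cmod c * b * hnorm H x"
      using b[OF x] bounded_op_closed[OF T x] by (simp add: hnorm_scale mult.assoc mult_left_mono)
  next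
    fix k x assume x: "x \<in> carrier H"
    then show "op_scale H c T (k \<odot> x) = k \<odot> op_scale H c T x"
      using bounded_op_closed[OF T x] smult_assoc1[of c k "T x"] smult_assoc1[of k c "T x"]
      by (simp add: bounded_op_scale[OF T] mult.commute)
  next
    fix x y assume "x \<in> carrier H" "y \<in> carrier H"
    then show "op_scale H c T (x \<oplus> y) = op_scale H c T x \<oplus> op_scale H c T y"
      using bounded_op_closed[OF T] by (simp add: bounded_op_add[OF T] smult_r_distr)
  qed (use bounded_op_closed[OF T] in \<open>simp_all add: op_scale_def\<close>)
qed

lemma op_add_bounded:
  assumes S: "S \<in> bounded_op H H" and T: "T \<in> bounded_op H H"
  shows "op_add H S T \<in> bounded_op H H"
proof -
  obtain a where a: "\<And>x. x \<in> carrier H \<Longrightarrow> hnorm H (S x) \<le> a * hnorm H x"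
    using bounded_op_bound[OF hilbert_space_axioms S] by metis
  obtain b where b: "\<And>x. x \<in> carrier H \<Longrightarrow> hnorm H (T x) \<le> b * hnorm H x"
    using bounded_op_bound[OF hilbert_space_axioms T] by metis
  note closed = bounded_op_closed[OF S] bounded_op_closed[OF T]
  show ?thesis
  proof (rule bounded_opI[where b = "a + b"])
    fix x assume x: "x \<in> carrier H"
    then show "hnorm H (op_add H S T x) \<le> (a + b) * hnorm H x"
      using a[OF x] b[OF x] hnorm_triangle[OF closed[OF x]] by (simp add: distrib_right)
  next
    fix k x assume x: "x \<in> carrier H"
    then show "op_add H S T (k \<odot> x) = k \<odot> op_add H S T x"
      by (simp add: bounded_op_scale[OF S] bounded_op_scale[OF T] closed smult_r_distr)
  next
    fix x y assume "x \<in> carrier H" "y \<in> carrier H"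
    then show "op_add H S T (x \<oplus> y) = op_add H S T x \<oplus> op_add H S T y"
      by (simp add: bounded_op_add[OF S] bounded_op_add[OF T] closed M.add.m_ac)
  qed (simp_all add: op_add_def closed)
qed

lemma op_comp_bounded:
  assumes S: "S \<in> bounded_op H H" and T: "T \<in> bounded_op H H"
  shows "op_comp H S T \<in> bounded_op H H"
proof -
  obtain a where a: "a \<ge> 0" "\<And>x. x \<in> carrier H \<Longrightarrow> hnorm H (S x) \<le> a * hnorm H x"
    using bounded_op_bound[OF hilbert_space_axioms S] by metis
  obtain b where b: "\<And>x. x \<in> carrier H \<Longrightarrow> hnorm H (T x) \<le> b * hnorm H x"
    using bounded_op_bound[OF hilbert_space_axioms T] by metis
  note closed = bounded_op_closed[OF S] bounded_op_closed[OF T]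
  show ?thesis
  proof (rule bounded_opI[where b = "a * b"])
    fix x assume x: "x \<in> carrier H"
    have "hnorm H (S (T x)) \<le> a * hnorm H (T x)" using x closed by (intro a(2))
    also have "\<dots> \<le> a * (b * hnorm H x)" using b[OF x] a(1) by (rule mult_left_mono)
    finally show "hnorm H (op_comp H S T x) \<le> a * b * hnorm H x" using x by (simp add: mult.assoc)
  qed (simp_all add: bounded_op_scale[OF S] bounded_op_scale[OF T] bounded_op_add[OF S]
      bounded_op_add[OF T] closed, simp add: op_comp_def)
qed

text \<open>Makes the family intersected by \<open>cstar_generated\<close> non-empty, and allows
  facts about subalgebras to be applied to arbitrary bounded operators.\<close>

lemma unital_cstar_subalgebra_bounded_op: "unital_cstar_subalgebra H (bounded_op H H)"
  unfolding unital_cstar_subalgebra_def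
  by (intro conjI ballI allI impI)
    (simp_all add: op_id_bounded op_add_bounded op_comp_bounded op_scale_bounded self.adjoint_op_closed)

lemma unital_cstar_subalgebraD:
  assumes "unital_cstar_subalgebra H \<A>"
  shows "T \<in> \<A> \<Longrightarrow> T \<in> bounded_op H H" and "op_id H \<in> \<A>"
    and "S \<in> \<A> \<Longrightarrow> T \<in> \<A> \<Longrightarrow> op_add H S T \<in> \<A>"
    and "S \<in> \<A> \<Longrightarrow> T \<in> \<A> \<Longrightarrow> op_comp H S T \<in> \<A>"
    and "T \<in> \<A> \<Longrightarrow> op_scale H c T \<in> \<A>"
    and "T \<in> \<A> \<Longrightarrow> adjoint_op H H T \<in> \<A>"
    and "\<lbrakk>\<And>n::nat. F n \<in> \<A>; T \<in> bounded_op H H; (\<lambda>n. op_norm H (op_diff H (F n) T)) \<longlonglongrightarrow> 0\<rbrakk>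
      \<Longrightarrow> T \<in> \<A>"
proof -
  note D = assms[unfolded unital_cstar_subalgebra_def]
  show "T \<in> \<A> \<Longrightarrow> T \<in> bounded_op H H" using D by (elim conjE) (rule subsetD)
  show "op_id H \<in> \<A>" using D by (elim conjE)
  show "S \<in> \<A> \<Longrightarrow> T \<in> \<A> \<Longrightarrow> op_add H S T \<in> \<A>"
    and "S \<in> \<A> \<Longrightarrow> T \<in> \<A> \<Longrightarrow> op_comp H S T \<in> \<A>"
    and "T \<in> \<A> \<Longrightarrow> op_scale H c T \<in> \<A>"
    and "T \<in> \<A> \<Longrightarrow> adjoint_op H H T \<in> \<A>"
    using D by simp_all
  show "T \<in> \<A>" if "\<And>n::nat. F n \<in> \<A>" "T \<in> bounded_op H H"
    "(\<lambda>n. op_norm H (op_diff H (F n) T)) \<longlonglongrightarrow> 0"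
    using D that by (elim conjE allE[of _ F] allE[of _ T]) simp
qed

text \<open>Every closure condition passes to intersections. Only the inclusion in
  \<open>bounded_op H H\<close> has to be taken from a member, whence the non-empty family.\<close>

lemma unital_cstar_subalgebra_Inter:
  assumes "\<C> \<noteq> {}" and \<C>: "\<And>\<A>. \<A> \<in> \<C> \<Longrightarrow> unital_cstar_subalgebra H \<A>"
  shows "unital_cstar_subalgebra H (\<Inter>\<C>)"
proof -
  obtain \<B> where \<B>: "\<B> \<in> \<C>" using assms(1) by (metis ex_in_conv)
  then have sub: "\<Inter>\<C> \<subseteq> bounded_op H H"
    using unital_cstar_subalgebraD(1)[OF \<C>[OF \<B>]] by auto
  have closed: "op_id H \<in> \<Inter>\<C>"
    "\<forall>S\<in>\<Inter>\<C>. \<forall>T\<in>\<Inter>\<C>. op_add H S T \<in> \<Inter>\<C> \<and> op_comp H S T \<in> \<Inter>\<C>"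
    "\<forall>c. \<forall>T\<in>\<Inter>\<C>. op_scale H c T \<in> \<Inter>\<C>" "\<forall>T\<in>\<Inter>\<C>. adjoint_op H H T \<in> \<Inter>\<C>"
    using unital_cstar_subalgebraD(2-6)[OF \<C>] by simp_all
  have limit: "\<forall>F T. (\<forall>n::nat. F n \<in> \<Inter>\<C>) \<and> T \<in> bounded_op H H \<and>
      (\<lambda>n. op_norm H (op_diff H (F n) T)) \<longlonglongrightarrow> 0 \<longrightarrow> T \<in> \<Inter>\<C>"
  proof (intro allI impI InterI, elim conjE)
    fix F :: "nat \<Rightarrow> 'a \<Rightarrow> 'a" and T \<A>
    assume "\<forall>n. F n \<in> \<Inter>\<C>" and T: "T \<in> bounded_op H H"
      "(\<lambda>n. op_norm H (op_diff H (F n) T)) \<longlonglongrightarrow> 0" and \<A>: "\<A> \<in> \<C>"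
    then have "F n \<in> \<A>" for n by simp
    from unital_cstar_subalgebraD(7)[OF \<C>[OF \<A>] this T] show "T \<in> \<A>" .
  qed
  show ?thesis
    unfolding unital_cstar_subalgebra_def by (intro conjI sub closed limit)
qed

lemma cstar_generated_subalgebra:
  assumes "range A \<subseteq> bounded_op H H"
  shows "unital_cstar_subalgebra H (cstar_generated H A)"
  unfolding cstar_generated_def hull_def
  using assms unital_cstar_subalgebra_bounded_op by (intro unital_cstar_subalgebra_Inter) auto

lemma generator_in_cstar_generated: "A i \<in> cstar_generated H A"
  unfolding cstar_generated_def by (rule hull_inc) simp

text \<open>Completeness in the operator norm, stated pointwise with an explicit rate
  \<open>e\<close>. The limit is taken at each vector by completeness of \<open>H\<close>; the rate
  is uniform up to the factor |x|, so it survives in the limit.\<close>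

lemma bounded_op_complete:
  assumes F: "\<And>n. F n \<in> bounded_op H H"
    and Cauchy: "\<And>n k x. x \<in> carrier H \<Longrightarrow> hnorm H (F (n + k) x \<ominus> F n x) \<le> e n * hnorm H x"
    and e: "e \<longlonglongrightarrow> (0 :: real)"
  obtains T where "T \<in> bounded_op H H"
    and "\<And>n x. x \<in> carrier H \<Longrightarrow> hnorm H (F n x \<ominus> T x) \<le> e n * hnorm H x"
proof -
  have "\<exists>y\<in>carrier H. (\<lambda>n. hnorm H (F n x \<ominus> y)) \<longlonglongrightarrow> 0" if x: "x \<in> carrier H" for x
  proof (rule complete)
    fix r :: real assume "r > 0"
    have "(\<lambda>n. e n * hnorm H x) \<longlonglongrightarrow> 0"
      using tendsto_mult_right[OF e, of "hnorm H x"] by simp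
    then have "\<forall>\<^sub>F n in sequentially. e n * hnorm H x < r / 2"
      using \<open>r > 0\<close> by (intro order_tendstoD(2)) auto
    then obtain M where M: "e M * hnorm H x < r / 2"
      by (auto simp: eventually_sequentially)
    have "hnorm H (F m x \<ominus> F n x) < r" if "m \<ge> M" "n \<ge> M" for m n
    proof -
      have near: "hnorm H (F k x \<ominus> F M x) < r / 2" if "k \<ge> M" for k
        using Cauchy[OF x, of M "k - M"] M that by simp
      have "hnorm H (F m x \<ominus> F n x) \<le> hnorm H (F m x \<ominus> F M x) + hnorm H (F M x \<ominus> F n x)"
        using bounded_op_closed[OF F x] by (intro hnorm_diff_triangle)
      with near[OF that(1)] near[OF that(2)] show ?thesis
        using hnorm_minus_commute[OF bounded_op_closed[OF F x] bounded_op_closed[OF F x], of M n]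
        by simp
    qed
    then show "\<exists>M. \<forall>m\<ge>M. \<forall>n\<ge>M. hnorm H (F m x \<ominus> F n x) < r" by blast
  qed (use bounded_op_closed[OF F x] in simp)
  then have "\<forall>x\<in>carrier H. \<exists>y. y \<in> carrier H \<and> (\<lambda>n. hnorm H (F n x \<ominus> y)) \<longlonglongrightarrow> 0" by blast
  from bchoice[OF this] obtain T0 where
    "\<forall>x\<in>carrier H. T0 x \<in> carrier H \<and> (\<lambda>n. hnorm H (F n x \<ominus> T0 x)) \<longlonglongrightarrow> 0" by blast
  then have T0: "\<And>x. x \<in> carrier H \<Longrightarrow> T0 x \<in> carrier H"
    "\<And>x. x \<in> carrier H \<Longrightarrow> (\<lambda>n. hnorm H (F n x \<ominus> T0 x)) \<longlonglongrightarrow> 0" by blast+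
  have lim: "(\<lambda>n. inner_prod H (F n x) y) \<longlonglongrightarrow> inner_prod H (T0 x) y"
    if "x \<in> carrier H" "y \<in> carrier H" for x y
    using bounded_op_closed[OF F that(1)] T0[OF that(1)] that(2) by (intro tendsto_inner_prod)
  \<comment> \<open>The Cauchy estimate between indices n and k + n, with k tending to
    infinity.\<close>
  have close: "hnorm H (F n x \<ominus> T0 x) \<le> e n * hnorm H x" if x: "x \<in> carrier H" for n x
  proof (rule LIMSEQ_le)
    show "(\<lambda>k. hnorm H (F n x \<ominus> T0 x)) \<longlonglongrightarrow> hnorm H (F n x \<ominus> T0 x)" by simp
    have "(\<lambda>k. hnorm H (F (k + n) x \<ominus> T0 x)) \<longlonglongrightarrow> 0"
      using T0(2)[OF x] by (rule LIMSEQ_ignore_initial_segment)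
    then show "(\<lambda>k. e n * hnorm H x + hnorm H (F (k + n) x \<ominus> T0 x)) \<longlonglongrightarrow> e n * hnorm H x"
      using tendsto_add[OF tendsto_const] by fastforce
    have "hnorm H (F n x \<ominus> T0 x) \<le> e n * hnorm H x + hnorm H (F (k + n) x \<ominus> T0 x)" for k
    proof -
      have "hnorm H (F n x \<ominus> T0 x) \<le> hnorm H (F n x \<ominus> F (k + n) x) + hnorm H (F (k + n) x \<ominus> T0 x)"
        using bounded_op_closed[OF F x] T0(1)[OF x] by (intro hnorm_diff_triangle)
      moreover have "hnorm H (F n x \<ominus> F (k + n) x) \<le> e n * hnorm H x"
        using Cauchy[OF x, of n k] hnorm_minus_commute[OF bounded_op_closed[OF F x] bounded_op_closed[OF F x], of n "n + k"]
        by (simp add: add.commute)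
      ultimately show ?thesis by simp
    qed
    then show "\<exists>M. \<forall>k\<ge>M. hnorm H (F n x \<ominus> T0 x) \<le> e n * hnorm H x + hnorm H (F (k + n) x \<ominus> T0 x)"
      by blast
  qed
  obtain b where b: "\<And>x. x \<in> carrier H \<Longrightarrow> hnorm H (F 0 x) \<le> b * hnorm H x"
    using bounded_op_bound[OF hilbert_space_axioms F] by metis
  define T where "T = restrict T0 (carrier H)"
  have "T \<in> bounded_op H H"
  \<comment> \<open>The limit differs from \<open>F 0\<close>, which has bound \<open>b\<close>, by
    at most \<open>e 0\<close>.\<close>
  proof (rule bounded_opI[where b = "b + e 0"])
    fix x assume x: "x \<in> carrier H"
    have "hnorm H (T0 x) \<le> hnorm H (F 0 x) + hnorm H (F 0 x \<ominus> T0 x)"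
      using hnorm_diff_ineq[OF bounded_op_closed[OF F x] T0(1)[OF x], of 0] by linarith
    with b[OF x] close[OF x, of 0] show "hnorm H (T x) \<le> (b + e 0) * hnorm H x"
      using x by (simp add: T_def distrib_right)
  next
    fix x y assume xy: "x \<in> carrier H" "y \<in> carrier H"
    have "T0 (x \<oplus> y) = T0 x \<oplus> T0 y"
    proof (rule inner_prod_ext)
      fix z assume z: "z \<in> carrier H"
      have "(\<lambda>n. inner_prod H (F n (x \<oplus> y)) z) \<longlonglongrightarrow> inner_prod H (T0 x) z + inner_prod H (T0 y) z"
        using tendsto_add[OF lim[OF xy(1) z] lim[OF xy(2) z]] bounded_op_closed[OF F] xy z
        by (simp add: bounded_op_add[OF F] inner_prod_add_left)
      with lim[of "x \<oplus> y" z] xy z show "inner_prod H (T0 (x \<oplus> y)) z = inner_prod H (T0 x \<oplus> T0 y) z"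
        by (simp add: inner_prod_add_left T0(1) LIMSEQ_unique)
    qed (use xy T0(1) in simp_all)
    then show "T (x \<oplus> y) = T x \<oplus> T y" using xy by (simp add: T_def)
  next
    fix c x assume x: "x \<in> carrier H"
    have "T0 (c \<odot> x) = c \<odot> T0 x"
    proof (rule inner_prod_ext)
      fix z assume z: "z \<in> carrier H"
      have "(\<lambda>n. inner_prod H (F n (c \<odot> x)) z) \<longlonglongrightarrow> c * inner_prod H (T0 x) z"
        using tendsto_mult_left[OF lim[OF x z], of c] bounded_op_closed[OF F] x z
        by (simp add: bounded_op_scale[OF F] inner_prod_smult_left)
      with lim[of "c \<odot> x" z] x z show "inner_prod H (T0 (c \<odot> x)) z = inner_prod H (c \<odot> T0 x) z"
        by (simp add: inner_prod_smult_left T0(1) LIMSEQ_unique)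
    qed (use x T0(1) in simp_all)
    then show "T (c \<odot> x) = c \<odot> T x" using x by (simp add: T_def)
  qed (simp_all add: T_def T0(1))
  moreover have "hnorm H (F n x \<ominus> T x) \<le> e n * hnorm H x" if "x \<in> carrier H" for n x
    using close[OF that] that by (simp add: T_def)
  ultimately show ?thesis using that by blast
qed

text \<open>On the zero space a negative \<open>b\<close> is possible although the norm of an
  operator is then 0, hence the absolute value.\<close>

lemma op_norm_le:
  assumes "\<And>x. x \<in> carrier H \<Longrightarrow> hnorm H (T x) \<le> b * hnorm H x"
  shows "op_norm H T \<le> \<bar>b\<bar>"
  unfolding op_norm_def
proof (rule cSup_least)
  show "{hnorm H (T x) |x. x \<in> carrier H \<and> hnorm H x \<le> 1} \<noteq> {}"
    using M.zero_closed hnorm_zero by (metis (mono_tags, lifting) empty_iff mem_Collect_eq zero_le_one)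
  fix r assume "r \<in> {hnorm H (T x) |x. x \<in> carrier H \<and> hnorm H x \<le> 1}"
  then obtain x where x: "r = hnorm H (T x)" "x \<in> carrier H" "hnorm H x \<le> 1" by blast
  have "b * hnorm H x \<le> \<bar>b\<bar> * 1" using x by (intro mult_mono) auto
  with assms[OF x(2)] x(1) show "r \<le> \<bar>b\<bar>" by simp
qed

lemma op_norm_nonneg:
  assumes "T \<in> bounded_op H H"
  shows "op_norm H T \<ge> 0"
  unfolding op_norm_def
proof (rule cSup_upper2)
  show "hnorm H (T \<zero>) \<in> {hnorm H (T x) |x. x \<in> carrier H \<and> hnorm H x \<le> 1}"
    using M.zero_closed hnorm_zero by (metis (mono_tags, lifting) mem_Collect_eq zero_le_one)
  show "hnorm H (T \<zero>) \<ge> 0" using bounded_op_closed[OF assms M.zero_closed] by simp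
  obtain b where b: "b \<ge> 0" "\<And>x. x \<in> carrier H \<Longrightarrow> hnorm H (T x) \<le> b * hnorm H x"
    using bounded_op_bound[OF hilbert_space_axioms assms] by metis
  show "bdd_above {hnorm H (T x) |x. x \<in> carrier H \<and> hnorm H x \<le> 1}"
  proof (rule bdd_aboveI)
    fix r assume "r \<in> {hnorm H (T x) |x. x \<in> carrier H \<and> hnorm H x \<le> 1}"
    then obtain x where x: "r = hnorm H (T x)" "x \<in> carrier H" "hnorm H x \<le> 1" by blast
    have "b * hnorm H x \<le> b * 1" using x b(1) by (intro mult_mono) auto
    with b(2)[OF x(2)] x(1) show "r \<le> b" by simp
  qed
qed

end

text \<open>A linear form with coefficients \<open>g\<close>, evaluated at an operator tuple. It
  serves for F_i = f_i(A), for the recovery of \<open>A\<close> from the F_i, and for g . N on the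
  dilation space.\<close>

definition op_lincomb ::
  "('a, 'c) hilbert_scheme \<Rightarrow> 'i set \<Rightarrow> ('i \<Rightarrow> complex) \<Rightarrow> ('i \<Rightarrow> 'a \<Rightarrow> 'a) \<Rightarrow> 'a \<Rightarrow> 'a" where
  "op_lincomb H J g A = (\<lambda>x\<in>carrier H. \<Oplus>\<^bsub>H\<^esub>j\<in>J. g j \<odot>\<^bsub>H\<^esub> A j x)"

section \<open>Linear combinations, numerical radius, and characters\<close>

context hilbert_space
begin

interpretation self: hilbert_space_pair H H
  by unfold_locales

lemma op_lincomb_closed:
  assumes \<A>: "unital_cstar_subalgebra H \<A>" and "finite J" and "\<And>j. j \<in> J \<Longrightarrow> A j \<in> \<A>"
  shows "op_lincomb H J g A \<in> \<A>"
    and "linear_functional_on H \<A> \<phi> \<Longrightarrow> \<phi> (op_lincomb H J g A) = (\<Sum>j\<in>J. g j * \<phi> (A j))"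
proof -
  have "op_lincomb H J g A \<in> \<A> \<and>
    (linear_functional_on H \<A> \<phi> \<longrightarrow> \<phi> (op_lincomb H J g A) = (\<Sum>j\<in>J. g j * \<phi> (A j)))"
    using assms(2,3)
  proof (induction J rule: finite_induct)
    case empty
    \<comment> \<open>The zero operator belongs to the algebra as a multiple of the identity, and
      linearity then gives it the value 0.\<close>
    have "op_lincomb H {} g A = op_scale H 0 (op_id H)"
      unfolding op_lincomb_def op_scale_def by (rule restrict_ext) simp
    moreover have "op_id H \<in> \<A>" by (rule unital_cstar_subalgebraD(2)[OF \<A>])
    ultimately show ?case
      using unital_cstar_subalgebraD(5)[OF \<A>, of "op_id H" 0] by (simp add: linear_functional_on_def)
  next
    case (insert a J)
    then have A: "A j \<in> bounded_op H H" if "j \<in> insert a J" for j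
      using unital_cstar_subalgebraD(1)[OF \<A>] that by blast
    have "op_lincomb H (insert a J) g A = op_add H (op_scale H (g a) (A a)) (op_lincomb H J g A)"
      unfolding op_lincomb_def op_add_def
    proof (rule restrict_ext)
      fix x assume x: "x \<in> carrier H"
      then have "(\<lambda>j. g j \<odot> A j x) \<in> J \<rightarrow> carrier H" "g a \<odot> A a x \<in> carrier H"
        using bounded_op_closed[OF A x] by auto
      then show "(\<Oplus>j\<in>insert a J. g j \<odot> A j x) =
        op_scale H (g a) (A a) x \<oplus> (\<lambda>x\<in>carrier H. \<Oplus>j\<in>J. g j \<odot> A j x) x"
        using insert.hyps x by simp
    qed
    moreover have "op_scale H (g a) (A a) \<in> \<A>" "A a \<in> \<A>"
      using unital_cstar_subalgebraD(5)[OF \<A>] insert.prems by auto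
    moreover have "op_lincomb H J g A \<in> \<A>" using insert by auto
    ultimately show ?case
      using insert.IH insert.prems insert.hyps unital_cstar_subalgebraD(3)[OF \<A>]
      by (auto simp: linear_functional_on_def)
  qed
  then show "op_lincomb H J g A \<in> \<A>"
    and "linear_functional_on H \<A> \<phi> \<Longrightarrow> \<phi> (op_lincomb H J g A) = (\<Sum>j\<in>J. g j * \<phi> (A j))"
    by simp_all
qed

lemma inner_prod_lincomb:
  assumes "finite J" and "\<And>j. j \<in> J \<Longrightarrow> A j \<in> bounded_op H H" and "x \<in> carrier H" "z \<in> carrier H"
  shows "inner_prod H (op_lincomb H J g A x) z = (\<Sum>j\<in>J. g j * inner_prod H (A j x) z)"
proof -
  have "(\<lambda>j. g j \<odot> A j x) \<in> J \<rightarrow> carrier H" using assms(2,3) by auto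
  with assms have "inner_prod H (op_lincomb H J g A x) z = (\<Sum>j\<in>J. inner_prod H (g j \<odot> A j x) z)"
    by (simp add: op_lincomb_def inner_prod_finsum_left)
  also have "\<dots> = (\<Sum>j\<in>J. g j * inner_prod H (A j x) z)"
    using assms bounded_op_closed[OF assms(2)] by (intro sum.cong) (auto simp: inner_prod_smult_left)
  finally show ?thesis .
qed

lemma selfadjoint_op_lincomb:
  assumes "finite J" and A: "\<And>j. j \<in> J \<Longrightarrow> selfadjoint_op H (A j)"
  shows "selfadjoint_op H (op_lincomb H J (\<lambda>j. complex_of_real (g j)) A)"
proof -
  have A': "A j \<in> bounded_op H H" if "j \<in> J" for j using A[OF that] by (simp add: selfadjoint_op_iff)
  let ?T = "op_lincomb H J (\<lambda>j. complex_of_real (g j)) A"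
  have T: "?T \<in> bounded_op H H"
    by (rule op_lincomb_closed(1)[OF unital_cstar_subalgebra_bounded_op assms(1) A'])
  moreover have "inner_prod H (?T x) y = inner_prod H x (?T y)"
    if xy: "x \<in> carrier H" "y \<in> carrier H" for x y
  proof -
    have "inner_prod H x (?T y) = cnj (inner_prod H (?T y) x)"
      by (rule inner_prod_commute[OF bounded_op_closed[OF T xy(2)] xy(1)])
    also have "\<dots> = (\<Sum>j\<in>J. complex_of_real (g j) * cnj (inner_prod H (A j y) x))"
      using xy assms(1) A' by (simp add: inner_prod_lincomb)
    also have "\<dots> = (\<Sum>j\<in>J. complex_of_real (g j) * inner_prod H (A j x) y)"
    proof (rule sum.cong)
      fix j assume j: "j \<in> J"
      have "cnj (inner_prod H (A j y) x) = inner_prod H x (A j y)"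
        by (rule inner_prod_commute[symmetric, OF bounded_op_closed[OF A'[OF j] xy(2)] xy(1)])
      also have "\<dots> = inner_prod H (A j x) y"
        using A[OF j] xy by (simp add: selfadjoint_op_iff)
      finally show "complex_of_real (g j) * cnj (inner_prod H (A j y) x) =
        complex_of_real (g j) * inner_prod H (A j x) y" by simp
    qed simp
    also have "\<dots> = inner_prod H (?T x) y"
      using xy assms(1) A' by (simp add: inner_prod_lincomb)
    finally show ?thesis by simp
  qed
  ultimately show ?thesis unfolding selfadjoint_op_iff by blast
qed

lemma selfadjoint_inner_real:
  assumes "selfadjoint_op H T" "x \<in> carrier H"
  shows "inner_prod H (T x) x = complex_of_real (Re (inner_prod H (T x) x))"
proof -
  have T: "T \<in> bounded_op H H" "inner_prod H (T x) x = inner_prod H x (T x)"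
    using assms by (simp_all add: selfadjoint_op_iff)
  then have "inner_prod H (T x) x = cnj (inner_prod H (T x) x)"
    using inner_prod_commute[OF bounded_op_closed[OF T(1) assms(2)] assms(2)] by simp
  then show ?thesis by (simp add: complex_eq_iff)
qed

text \<open>Polarisation writes 4 Re <T x, y> as the difference of the forms at x + y and x - y; the
  parallelogram law then bounds it by 2 b (|x|^2 + |y|^2). Choosing \<open>y\<close> along T x turns
  this into a norm bound.\<close>

lemma selfadjoint_norm_le_numerical_radius:
  assumes T: "selfadjoint_op H T" and "b \<ge> 0"
    and form: "\<And>x. x \<in> carrier H \<Longrightarrow> \<bar>Re (inner_prod H (T x) x)\<bar> \<le> b * (hnorm H x)\<^sup>2"
    and x: "x \<in> carrier H"
  shows "hnorm H (T x) \<le> b * hnorm H x"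
proof -
  have T': "T \<in> bounded_op H H"
    "\<And>x y. x \<in> carrier H \<Longrightarrow> y \<in> carrier H \<Longrightarrow> inner_prod H (T x) y = inner_prod H x (T y)"
    using T by (simp_all add: selfadjoint_op_iff)
  note closed = bounded_op_closed[OF T'(1)]
  have polar: "2 * Re (inner_prod H (T x) y) \<le> b * ((hnorm H x)\<^sup>2 + (hnorm H y)\<^sup>2)"
    if y: "y \<in> carrier H" for y
  proof -
    have sym: "Re (inner_prod H (T y) x) = Re (inner_prod H (T x) y)"
      using T'(2)[OF y x] inner_prod_commute[OF closed[OF x] y] by simp
    have "4 * Re (inner_prod H (T x) y) =
        Re (inner_prod H (T (x \<oplus> y)) (x \<oplus> y)) - Re (inner_prod H (T (x \<ominus> y)) (x \<ominus> y))"
      using x y closed sym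
      by (simp add: bounded_op_add[OF T'(1)] self.bounded_op_diff[OF T'(1)] inner_prod_simps)
    also have "\<dots> \<le> b * (hnorm H (x \<oplus> y))\<^sup>2 + b * (hnorm H (x \<ominus> y))\<^sup>2"
      using form[of "x \<oplus> y"] form[of "x \<ominus> y"] x y by simp
    also have "\<dots> = 2 * (b * ((hnorm H x)\<^sup>2 + (hnorm H y)\<^sup>2))"
      using x y by (simp add: hnorm_add_sq hnorm_diff_sq algebra_simps)
    finally show ?thesis by simp
  qed
  \<comment> \<open>This is y = t T x. The value t = 1 / b balances the two terms on the right; for
    b = 0 already t = 1 forces T x = 0.\<close>
  have scaled: "2 * t * (hnorm H (T x))\<^sup>2 \<le> b * ((hnorm H x)\<^sup>2 + t\<^sup>2 * (hnorm H (T x))\<^sup>2)" for t :: real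
    using polar[of "complex_of_real t \<odot> T x"] closed[OF x]
    by (simp add: inner_prod_smult_right hnorm_scale power_mult_distrib hnorm_sq mult.assoc)
  have "(hnorm H (T x))\<^sup>2 \<le> (b * hnorm H x)\<^sup>2"
  proof (cases "b = 0")
    case True
    then show ?thesis using scaled[of 1] by simp
  next
    case False
    then show ?thesis using scaled[of "1 / b"] \<open>b \<ge> 0\<close> by (simp add: field_simps power2_eq_square)
  qed
  moreover have "0 \<le> b * hnorm H x" using \<open>b \<ge> 0\<close> x by simp
  ultimately show ?thesis by (rule power2_le_imp_le)
qed

text \<open>Through these states the hypothesis on \<open>W1\<close> reaches the quadratic forms of
  \<open>A\<close>. Positivity is <T* T x, x> = |T x|^2.\<close>

lemma vector_state:
  assumes \<A>: "unital_cstar_subalgebra H \<A>" and x: "x \<in> carrier H" "hnorm H x = 1"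
  shows "state_on H \<A> (\<lambda>T. inner_prod H (T x) x)"
  unfolding state_on_def linear_functional_on_def
proof (intro conjI ballI allI)
  fix S T assume "S \<in> \<A>" "T \<in> \<A>"
  then show "inner_prod H (op_add H S T x) x = inner_prod H (S x) x + inner_prod H (T x) x"
    using bounded_op_closed[OF unital_cstar_subalgebraD(1)[OF \<A>] x(1)] x by (simp add: inner_prod_add_left)
next
  fix c T assume "T \<in> \<A>"
  then show "inner_prod H (op_scale H c T x) x = c * inner_prod H (T x) x"
    using bounded_op_closed[OF unital_cstar_subalgebraD(1)[OF \<A>] x(1)] x by (simp add: inner_prod_smult_left)
next
  fix T assume "T \<in> \<A>"
  then have T: "T \<in> bounded_op H H" by (rule unital_cstar_subalgebraD(1)[OF \<A>])
  show "inner_prod H (op_comp H (adjoint_op H H T) T x) x \<in> \<real>\<^sub>\<ge>\<^sub>0"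
    using self.inner_prod_adjoint(2)[OF T x(1) bounded_op_closed[OF T x(1)]]
      inner_prod_nonneg[OF bounded_op_closed[OF T x(1)]] x by simp
next
  show "inner_prod H (op_id H x) x = 1" using x by (simp add: inner_prod_self)
qed

text \<open>Multiplicativity gives \<phi> T = \<phi> T * \<phi> (id), and a character is nonzero at
  some \<open>T\<close>.\<close>

lemma character_id:
  assumes "unital_cstar_subalgebra H \<A>" "character_on H \<A> \<phi>"
  shows "\<phi> (op_id H) = 1"
proof -
  obtain T where T: "T \<in> \<A>" "\<phi> T \<noteq> 0" using assms(2) unfolding character_on_def by blast
  have "op_id H \<in> \<A>" "T \<in> bounded_op H H"
    using unital_cstar_subalgebraD(1,2)[OF assms(1)] T by auto
  then have "op_comp H T (op_id H) = T"
    by (intro bounded_op_eqI[of _ H H] op_comp_bounded op_id_bounded) simp_all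
  then have "\<phi> T = \<phi> T * \<phi> (op_id H)"
    using assms(2) T(1) \<open>op_id H \<in> \<A>\<close> unfolding character_on_def by metis
  then show ?thesis using T(2) by simp
qed

text \<open>If \<open>T\<close> is a strict contraction with \<open>\<phi> T = 1\<close>, then applying \<open>\<phi>\<close> to the Neumann series
  \<open>R = T + T R\<close> gives \<open>\<phi> R = 1 + \<phi> R\<close>.\<close>

lemma character_contraction_neq_1:
  assumes \<A>: "unital_cstar_subalgebra H \<A>" and \<phi>: "character_on H \<A> \<phi>"
    and T: "T \<in> \<A>" and r: "0 \<le> r" "r < 1"
    and contr: "\<And>x. x \<in> carrier H \<Longrightarrow> hnorm H (T x) \<le> r * hnorm H x"
  shows "\<phi> T \<noteq> 1"
proof
  assume "\<phi> T = 1"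
  \<comment> \<open>The partial sum T + ... + T^(n+1). It starts at \<open>T\<close> and not at the
    identity, so that the limit satisfies R = T + T R.\<close>
  define P where "P n = ((\<lambda>S. op_add H T (op_comp H T S)) ^^ n) T" for n
  have P_Suc: "P (Suc n) = op_add H T (op_comp H T (P n))" for n by (simp add: P_def)
  have P: "P n \<in> \<A>" for n
  proof (induction n)
    case 0
    then show ?case using T by (simp add: P_def)
  next
    case (Suc n)
    then show ?case using unital_cstar_subalgebraD(3,4)[OF \<A>] T by (simp add: P_Suc)
  qed
  have T': "T \<in> bounded_op H H" using unital_cstar_subalgebraD(1)[OF \<A> T] .
  have P': "P n \<in> bounded_op H H" for n using unital_cstar_subalgebraD(1)[OF \<A> P] .
  note closed = bounded_op_closed[OF T'] bounded_op_closed[OF P']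
  \<comment> \<open>The geometric sum r + r^2 + ..., that is, the solution of C = r + r C. This
    fixed point equation is what carries the induction for the bound on \<open>P n\<close>.\<close>
  define C where "C = r / (1 - r)"
  have C: "C \<ge> 0" "r + r * C = C" using r by (simp_all add: C_def field_simps)
  have P_bound: "hnorm H (P n x) \<le> C * hnorm H x" if x: "x \<in> carrier H" for n x
  proof (induction n)
    case 0
    have "r \<le> C" using C r by (metis le_add_same_cancel1 mult_nonneg_nonneg)
    then have "r * hnorm H x \<le> C * hnorm H x" using x by (simp add: mult_right_mono)
    then show ?case using contr[OF x] by (simp add: P_def)
  next
    case (Suc n)
    have "hnorm H (P (Suc n) x) \<le> hnorm H (T x) + hnorm H (T (P n x))"
      using x closed by (simp add: P_Suc hnorm_triangle)
    also have "\<dots> \<le> r * hnorm H x + r * (C * hnorm H x)"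
      using contr[OF x] contr[OF closed(2)[OF x, of n]] mult_left_mono[OF Suc.IH r(1)] by linarith
    also have "\<dots> = (r + r * C) * hnorm H x" by (simp add: algebra_simps)
    finally show ?case using C(2) by simp
  qed
  \<comment> \<open>In the difference of two successors the summand \<open>T\<close> cancels and a
    factor \<open>T\<close> remains, so each step gains a factor \<open>r\<close>; the start is the
    crude bound 2 C.\<close>
  have P_diff: "hnorm H (P (n + k) x \<ominus> P n x) \<le> r ^ n * (2 * C) * hnorm H x"
    if x: "x \<in> carrier H" for n k x
  proof (induction n)
    case 0
    have "hnorm H (P k x \<ominus> P 0 x) \<le> hnorm H (P k x) + hnorm H (P 0 x)"
      by (rule hnorm_diff_le[OF closed(2)[OF x] closed(2)[OF x]])
    then show ?case using P_bound[OF x, of k] P_bound[OF x, of 0] by simp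
  next
    case (Suc n)
    have "P (Suc n + k) x \<ominus> P (Suc n) x = T (P (n + k) x \<ominus> P n x)"
    proof (rule inner_prod_ext)
      fix z assume z: "z \<in> carrier H"
      show "inner_prod H (P (Suc n + k) x \<ominus> P (Suc n) x) z = inner_prod H (T (P (n + k) x \<ominus> P n x)) z"
        using x z closed by (simp add: P_Suc self.bounded_op_diff[OF T'] inner_prod_simps)
    qed (use closed x in simp_all)
    then have "hnorm H (P (Suc n + k) x \<ominus> P (Suc n) x) \<le> r * hnorm H (P (n + k) x \<ominus> P n x)"
      using contr[of "P (n + k) x \<ominus> P n x"] closed x by simp
    also have "\<dots> \<le> r * (r ^ n * (2 * C) * hnorm H x)"
      using Suc.IH r(1) by (rule mult_left_mono)
    finally show ?case by (simp add: mult_ac)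
  qed
  have lim: "(\<lambda>n. r ^ n * (2 * C)) \<longlonglongrightarrow> 0"
    using tendsto_mult_right[OF LIMSEQ_realpow_zero[OF r], of "2 * C"] by simp
  from bounded_op_complete[OF P' P_diff lim]
  obtain R where R: "R \<in> bounded_op H H"
    and PR: "\<And>n x. x \<in> carrier H \<Longrightarrow> hnorm H (P n x \<ominus> R x) \<le> r ^ n * (2 * C) * hnorm H x"
    by metis
  have "(\<lambda>n. op_norm H (op_diff H (P n) R)) \<longlonglongrightarrow> 0"
  proof (rule tendsto_sandwich)
    have "op_diff H (P n) R = op_add H (P n) (op_scale H (-1) R)" for n
      unfolding op_diff_def op_add_def
      using bounded_op_closed[OF R] by (intro restrict_ext) (simp add: a_minus_def minus_eq_scale)
    then have "op_diff H (P n) R \<in> bounded_op H H" for n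
      using op_add_bounded[OF P' op_scale_bounded[OF R]] by simp
    then show "\<forall>\<^sub>F n in sequentially. 0 \<le> op_norm H (op_diff H (P n) R)"
      by (intro always_eventually allI op_norm_nonneg)
    have "op_norm H (op_diff H (P n) R) \<le> \<bar>r ^ n * (2 * C)\<bar>" for n
      using PR by (intro op_norm_le) simp
    then show "\<forall>\<^sub>F n in sequentially. op_norm H (op_diff H (P n) R) \<le> r ^ n * (2 * C)"
      using r(1) C(1) by (intro always_eventually allI) simp
  qed (use lim in simp_all)
  \<comment> \<open>Norm-closedness of the algebra puts the limit into the domain of \<phi>. From
    here on only algebraic properties of \<phi> enter, not continuity.\<close>
  then have R\<A>: "R \<in> \<A>" by (rule unital_cstar_subalgebraD(7)[OF \<A> P R])
  have TR: "op_comp H T R \<in> \<A>" by (rule unital_cstar_subalgebraD(4)[OF \<A> T R\<A>])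
  have "R = op_add H T (op_comp H T R)"
  proof (rule bounded_op_eqI[OF R])
    show "op_add H T (op_comp H T R) \<in> bounded_op H H"
      by (rule unital_cstar_subalgebraD(1)[OF \<A> unital_cstar_subalgebraD(3)[OF \<A> T TR]])
    fix x assume x: "x \<in> carrier H"
    have Rx: "R x \<in> carrier H" by (rule bounded_op_closed[OF R x])
    have "(\<lambda>n. hnorm H (P n x \<ominus> R x)) \<longlonglongrightarrow> 0"
    proof (rule Lim_null_comparison)
      show "\<forall>\<^sub>F n in sequentially. norm (hnorm H (P n x \<ominus> R x)) \<le> r ^ n * (2 * C) * hnorm H x"
        using PR[OF x] closed(2)[OF x] Rx by (intro always_eventually allI) simp
      show "(\<lambda>n. r ^ n * (2 * C) * hnorm H x) \<longlonglongrightarrow> 0"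
        using tendsto_mult_right[OF lim, of "hnorm H x"] by simp
    qed
    then have conv: "(\<lambda>n. inner_prod H (P n x) z) \<longlonglongrightarrow> inner_prod H (R x) z" if "z \<in> carrier H" for z
      using closed(2)[OF x] Rx that by (intro tendsto_inner_prod)
    show "R x = op_add H T (op_comp H T R) x"
    proof (rule inner_prod_ext)
      fix z assume z: "z \<in> carrier H"
      \<comment> \<open>Moving \<open>T\<close> to the other side as an adjoint makes the recursion
        a relation between inner products with \<open>P n x\<close>, which passes to the limit by
        weak convergence.\<close>
      have adj: "adjoint_op H H T z \<in> carrier H"
        by (rule bounded_op_closed[OF self.adjoint_op_closed[OF T'] z])
      have "(\<lambda>n. inner_prod H (T x) z + inner_prod H (P n x) (adjoint_op H H T z))
        \<longlonglongrightarrow> inner_prod H (T x) z + inner_prod H (R x) (adjoint_op H H T z)"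
        by (intro tendsto_intros conv adj)
      moreover have "inner_prod H (P (Suc n) x) z =
        inner_prod H (T x) z + inner_prod H (P n x) (adjoint_op H H T z)" for n
        using x z closed self.inner_prod_adjoint(1)[OF T' closed(2)[OF x] z]
        by (simp add: P_Suc inner_prod_add_left)
      ultimately have "(\<lambda>n. inner_prod H (P (Suc n) x) z)
        \<longlonglongrightarrow> inner_prod H (T x) z + inner_prod H (R x) (adjoint_op H H T z)" by simp
      moreover have "(\<lambda>n. inner_prod H (P (Suc n) x) z) \<longlonglongrightarrow> inner_prod H (R x) z"
        using conv[OF z] by (rule LIMSEQ_Suc)
      ultimately have "inner_prod H (R x) z =
        inner_prod H (T x) z + inner_prod H (R x) (adjoint_op H H T z)"
        using LIMSEQ_unique by metis
      then show "inner_prod H (R x) z = inner_prod H (op_add H T (op_comp H T R) x) z"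
        using x z closed(1) Rx self.inner_prod_adjoint(1)[OF T' Rx z] by (simp add: inner_prod_add_left)
    qed (use x Rx closed(1) in simp_all)
  qed
  then have "\<phi> R = \<phi> (op_add H T (op_comp H T R))" by simp
  also have "\<dots> = \<phi> T + \<phi> T * \<phi> R"
    using \<phi> T R\<A> TR unfolding character_on_def linear_functional_on_def by simp
  finally show False using \<open>\<phi> T = 1\<close> by simp
qed

text \<open>If |\<phi> T| exceeded \<open>b\<close>, then T / \<phi> T would be a strict contraction
  on which \<phi> has the value 1.\<close>

lemma character_bound:
  assumes \<A>: "unital_cstar_subalgebra H \<A>" and \<phi>: "character_on H \<A> \<phi>"
    and T: "T \<in> \<A>" and "0 \<le> b"
    and bound: "\<And>x. x \<in> carrier H \<Longrightarrow> hnorm H (T x) \<le> b * hnorm H x"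
  shows "cmod (\<phi> T) \<le> b"
proof (rule ccontr)
  assume "\<not> cmod (\<phi> T) \<le> b"
  then have less: "b < cmod (\<phi> T)" and nz: "\<phi> T \<noteq> 0" using \<open>0 \<le> b\<close> by auto
  let ?S = "op_scale H (1 / \<phi> T) T"
  have S: "?S \<in> \<A>" by (rule unital_cstar_subalgebraD(5)[OF \<A> T])
  have "\<phi> ?S = 1"
    using \<phi> T nz unfolding character_on_def linear_functional_on_def by simp
  moreover have "\<phi> ?S \<noteq> 1"
  proof (rule character_contraction_neq_1[OF \<A> \<phi> S])
    show "0 \<le> b / cmod (\<phi> T)" "b / cmod (\<phi> T) < 1"
      using less \<open>0 \<le> b\<close> nz by (simp_all add: divide_less_eq)
    fix x assume x: "x \<in> carrier H"
    have "T x \<in> carrier H" by (rule bounded_op_closed[OF unital_cstar_subalgebraD(1)[OF \<A> T] x])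
    then show "hnorm H (?S x) \<le> b / cmod (\<phi> T) * hnorm H x"
      using x bound[OF x] nz by (simp add: hnorm_scale norm_divide field_simps)
  qed
  ultimately show False by simp
qed

text \<open>A self-adjoint \<open>T\<close> satisfies \<open>\<parallel>(T + i s) x\<parallel>\<^sup>2 = \<parallel>T x\<parallel>\<^sup>2 + s\<^sup>2 \<parallel>x\<parallel>\<^sup>2\<close>, so
  \<open>\<bar>\<phi> T + i s\<bar>\<^sup>2 \<le> b\<^sup>2 + s\<^sup>2\<close> for all real \<open>s\<close>, which forces \<open>\<phi> T\<close> to be real.\<close>

lemma character_selfadjoint:
  assumes \<A>: "unital_cstar_subalgebra H \<A>" and \<phi>: "character_on H \<A> \<phi>"
    and T: "T \<in> \<A>" "selfadjoint_op H T" and "0 \<le> b"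
    and bound: "\<And>x. x \<in> carrier H \<Longrightarrow> hnorm H (T x) \<le> b * hnorm H x"
  shows "Im (\<phi> T) = 0" and "\<bar>Re (\<phi> T)\<bar> \<le> b"
proof -
  have "(Re (\<phi> T))\<^sup>2 + (Im (\<phi> T) + s)\<^sup>2 \<le> b\<^sup>2 + s\<^sup>2" for s :: real
  proof -
    let ?I = "op_scale H (\<i> * complex_of_real s) (op_id H)"
    let ?S = "op_add H T ?I"
    have I: "op_id H \<in> \<A>" "?I \<in> \<A>" "?S \<in> \<A>"
      using unital_cstar_subalgebraD(2,3,5)[OF \<A>] T(1) by simp_all
    have "\<phi> ?S = \<phi> T + \<i> * complex_of_real s"
      using \<phi> T(1) I character_id[OF \<A> \<phi>] unfolding character_on_def linear_functional_on_def by simp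
    moreover have "cmod (\<phi> ?S) \<le> sqrt (b\<^sup>2 + s\<^sup>2)"
    proof (rule character_bound[OF \<A> \<phi> I(3)])
      fix x assume x: "x \<in> carrier H"
      have Tx: "T x \<in> carrier H"
        by (rule bounded_op_closed[OF unital_cstar_subalgebraD(1)[OF \<A> T(1)] x])
      \<comment> \<open>The cross term in |T x + i s x|^2 vanishes: <T x, x> is real, so <T x, i s
        x> is purely imaginary.\<close>
      have "Re (inner_prod H (T x) ((\<i> * complex_of_real s) \<odot> x)) = 0"
        using x Tx by (simp add: inner_prod_smult_right, subst selfadjoint_inner_real[OF T(2) x]) simp
      then have "(hnorm H (?S x))\<^sup>2 = (hnorm H (T x))\<^sup>2 + s\<^sup>2 * (hnorm H x)\<^sup>2"
        using x Tx by (simp add: hnorm_add_sq hnorm_scale norm_mult power_mult_distrib)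
      also have "\<dots> \<le> (b * hnorm H x)\<^sup>2 + s\<^sup>2 * (hnorm H x)\<^sup>2"
        using bound[OF x] Tx by (simp add: power_mono)
      also have "\<dots> = (sqrt (b\<^sup>2 + s\<^sup>2) * hnorm H x)\<^sup>2"
        by (simp add: power_mult_distrib algebra_simps)
      finally show "hnorm H (?S x) \<le> sqrt (b\<^sup>2 + s\<^sup>2) * hnorm H x"
        by (rule power2_le_imp_le) (use x in simp)
    qed simp
    ultimately have "(cmod (\<phi> T + \<i> * complex_of_real s))\<^sup>2 \<le> b\<^sup>2 + s\<^sup>2"
      by (metis norm_ge_zero real_sqrt_le_iff real_sqrt_abs abs_of_nonneg)
    then show ?thesis by (simp add: cmod_power2)
  qed
  \<comment> \<open>The term s^2 cancels and leaves an inequality affine in \<open>s\<close>, valid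
    for all real \<open>s\<close>. If Im (\<phi> T) were nonzero, s = (b^2 + 1) / (2 Im (\<phi> T))
    would violate it.\<close>
  then have *: "(Re (\<phi> T))\<^sup>2 + (Im (\<phi> T))\<^sup>2 + 2 * Im (\<phi> T) * s \<le> b\<^sup>2" for s :: real
    by (smt (verit) power2_sum)
  show Im: "Im (\<phi> T) = 0"
  proof (rule ccontr)
    assume nz: "Im (\<phi> T) \<noteq> 0"
    have "(Re (\<phi> T))\<^sup>2 + (Im (\<phi> T))\<^sup>2 + (b\<^sup>2 + 1) \<le> b\<^sup>2"
      using *[of "(b\<^sup>2 + 1) / (2 * Im (\<phi> T))"] nz by simp
    moreover have "(Re (\<phi> T))\<^sup>2 \<ge> 0" "(Im (\<phi> T))\<^sup>2 \<ge> 0" by simp_all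
    ultimately show False by linarith
  qed
  show "\<bar>Re (\<phi> T)\<bar> \<le> b"
    using *[of 0] Im \<open>0 \<le> b\<close> by (simp add: abs_le_square_iff[symmetric])
qed

end

section \<open>Direct powers\<close>

text \<open>The index is a set and not a type: with an initial segment of the naturals as
  \<open>I\<close>, the carrier lies in the type \<open>nat \<Rightarrow> 'a\<close> prescribed for
  the dilation space. Extensional functions make equality of vectors componentwise equality on
  \<open>I\<close>.\<close>

definition direct_power :: "'i set \<Rightarrow> ('a, 'c) hilbert_scheme \<Rightarrow> ('i \<Rightarrow> 'a) hilbert" where
  "direct_power I H = \<lparr>carrier = I \<rightarrow>\<^sub>E carrier H, monoid.mult = (\<lambda>x y. x),
     one = (\<lambda>i\<in>I. \<zero>\<^bsub>H\<^esub>), ring.zero = (\<lambda>i\<in>I. \<zero>\<^bsub>H\<^esub>), add = (\<lambda>x y. \<lambda>i\<in>I. x i \<oplus>\<^bsub>H\<^esub> y i),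
     smult = (\<lambda>c x. \<lambda>i\<in>I. c \<odot>\<^bsub>H\<^esub> x i),
     inner_prod = (\<lambda>x y. \<Sum>i\<in>I. inner_prod H (x i) (y i))\<rparr>"

lemma direct_power_simps [simp]:
  "carrier (direct_power I H) = I \<rightarrow>\<^sub>E carrier H"
  "\<zero>\<^bsub>direct_power I H\<^esub> = (\<lambda>i\<in>I. \<zero>\<^bsub>H\<^esub>)"
  "x \<oplus>\<^bsub>direct_power I H\<^esub> y = (\<lambda>i\<in>I. x i \<oplus>\<^bsub>H\<^esub> y i)"
  "c \<odot>\<^bsub>direct_power I H\<^esub> x = (\<lambda>i\<in>I. c \<odot>\<^bsub>H\<^esub> x i)"
  "inner_prod (direct_power I H) x y = (\<Sum>i\<in>I. inner_prod H (x i) (y i))"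
  by (simp_all add: direct_power_def)

definition diag_op ::
  "'i set \<Rightarrow> ('a, 'c) hilbert_scheme \<Rightarrow> ('i \<Rightarrow> 'a \<Rightarrow> 'a) \<Rightarrow> ('i \<Rightarrow> 'a) \<Rightarrow> 'i \<Rightarrow> 'a" where
  "diag_op I H G = (\<lambda>v\<in>I \<rightarrow>\<^sub>E carrier H. \<lambda>i\<in>I. G i (v i))"

lemma diag_op_apply:
  "v \<in> I \<rightarrow>\<^sub>E carrier H \<Longrightarrow> i \<in> I \<Longrightarrow> diag_op I H G v i = G i (v i)"
  by (simp add: diag_op_def)

section \<open>Finite direct powers and block-diagonal operators\<close>

context hilbert_space
begin

lemma direct_power_ext:
  assumes "x \<in> I \<rightarrow>\<^sub>E carrier H" "y \<in> I \<rightarrow>\<^sub>E carrier H" "\<And>i. i \<in> I \<Longrightarrow> x i = y i"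
  shows "x = y"
  using assms by (rule PiE_ext)

lemma module_direct_power: "module (ring_of_type_algebra :: complex ring) (direct_power I H)"
proof (rule moduleI)
  show "cring (ring_of_type_algebra :: complex ring)" by (rule cring_from_type_algebra)
  show "abelian_group (direct_power I H)"
  proof (rule abelian_groupI)
    fix x assume x: "x \<in> carrier (direct_power I H)"
    then have x_comp: "x i \<in> carrier H" if "i \<in> I" for i using that by auto
    have "(\<lambda>i\<in>I. \<ominus> x i) \<oplus>\<^bsub>direct_power I H\<^esub> x = \<zero>\<^bsub>direct_power I H\<^esub>"
      using x by (auto intro!: restrict_ext M.l_neg)
    moreover have "(\<lambda>i\<in>I. \<ominus> x i) \<in> carrier (direct_power I H)" using x by auto
    ultimately show "\<exists>y\<in>carrier (direct_power I H). y \<oplus>\<^bsub>direct_power I H\<^esub> x = \<zero>\<^bsub>direct_power I H\<^esub>"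
      by blast
    show "\<zero>\<^bsub>direct_power I H\<^esub> \<oplus>\<^bsub>direct_power I H\<^esub> x = x"
      using x by (intro direct_power_ext[of _ I]) (auto simp: x_comp)
  next
    fix x y assume xy: "x \<in> carrier (direct_power I H)" "y \<in> carrier (direct_power I H)"
    then show "x \<oplus>\<^bsub>direct_power I H\<^esub> y \<in> carrier (direct_power I H)" by auto
    show "x \<oplus>\<^bsub>direct_power I H\<^esub> y = y \<oplus>\<^bsub>direct_power I H\<^esub> x"
      using xy by (auto intro!: restrict_ext M.a_comm)
    fix z assume z: "z \<in> carrier (direct_power I H)"
    show "x \<oplus>\<^bsub>direct_power I H\<^esub> y \<oplus>\<^bsub>direct_power I H\<^esub> z =
      x \<oplus>\<^bsub>direct_power I H\<^esub> (y \<oplus>\<^bsub>direct_power I H\<^esub> z)"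
      using xy z by (auto intro!: restrict_ext M.a_assoc)
  qed auto
next
  fix a b :: complex and x y
  assume x: "x \<in> carrier (direct_power I H)"
  then have x_comp: "x i \<in> carrier H" if "i \<in> I" for i using that by auto
  then show "a \<odot>\<^bsub>direct_power I H\<^esub> x \<in> carrier (direct_power I H)" by auto
  show "(a \<oplus>\<^bsub>ring_of_type_algebra\<^esub> b) \<odot>\<^bsub>direct_power I H\<^esub> x =
      a \<odot>\<^bsub>direct_power I H\<^esub> x \<oplus>\<^bsub>direct_power I H\<^esub> b \<odot>\<^bsub>direct_power I H\<^esub> x"
    using x smult_l_distr[of a b] by (auto simp: x_comp intro!: restrict_ext)
  show "(a \<otimes>\<^bsub>ring_of_type_algebra\<^esub> b) \<odot>\<^bsub>direct_power I H\<^esub> x =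
      a \<odot>\<^bsub>direct_power I H\<^esub> (b \<odot>\<^bsub>direct_power I H\<^esub> x)"
    using x smult_assoc1[of a b] by (auto simp: x_comp intro!: restrict_ext)
  show "\<one>\<^bsub>ring_of_type_algebra\<^esub> \<odot>\<^bsub>direct_power I H\<^esub> x = x"
    using x smult_one by (intro direct_power_ext[of _ I]) auto
  assume "y \<in> carrier (direct_power I H)"
  then have y_comp: "y i \<in> carrier H" if "i \<in> I" for i using that by auto
  show "a \<odot>\<^bsub>direct_power I H\<^esub> (x \<oplus>\<^bsub>direct_power I H\<^esub> y) =
      a \<odot>\<^bsub>direct_power I H\<^esub> x \<oplus>\<^bsub>direct_power I H\<^esub> a \<odot>\<^bsub>direct_power I H\<^esub> y"
    using smult_r_distr[of a] by (auto simp: x_comp y_comp intro!: restrict_ext)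
qed

lemma hnorm_direct_power:
  assumes "x \<in> I \<rightarrow>\<^sub>E carrier H"
  shows "hnorm (direct_power I H) x = sqrt (\<Sum>i\<in>I. (hnorm H (x i))\<^sup>2)"
proof -
  have "(\<Sum>i\<in>I. Re (inner_prod H (x i) (x i))) = (\<Sum>i\<in>I. (hnorm H (x i))\<^sup>2)"
    using assms by (intro sum.cong refl hnorm_sq[symmetric]) auto
  then show ?thesis by (simp add: hnorm_def[of "direct_power I H"])
qed

lemma hnorm_component_le:
  assumes "finite I" "x \<in> I \<rightarrow>\<^sub>E carrier H" "i \<in> I"
  shows "hnorm H (x i) \<le> hnorm (direct_power I H) x"
proof -
  have "(hnorm H (x i))\<^sup>2 \<le> (\<Sum>i\<in>I. (hnorm H (x i))\<^sup>2)"
    using assms by (intro member_le_sum) auto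
  then show ?thesis using assms(2) by (simp add: hnorm_direct_power real_le_rsqrt)
qed

lemma minus_direct_power:
  assumes "x \<in> I \<rightarrow>\<^sub>E carrier H" "y \<in> I \<rightarrow>\<^sub>E carrier H"
  shows "x \<ominus>\<^bsub>direct_power I H\<^esub> y = (\<lambda>i\<in>I. x i \<ominus> y i)"
proof -
  interpret D: module "ring_of_type_algebra :: complex ring" "direct_power I H"
    by (rule module_direct_power)
  have "\<ominus>\<^bsub>direct_power I H\<^esub> y = (\<lambda>i\<in>I. \<ominus> y i)"
    using assms(2) by (intro D.M.minus_equality) (auto intro!: restrict_ext M.l_neg)
  then show ?thesis by (auto simp: a_minus_def intro!: restrict_ext)
qed

text \<open>The norm dominates each component and is a continuous function of finitely many
  component norms, so convergence is componentwise and completeness is inherited.\<close>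

lemma hilbert_space_direct_power:
  assumes "finite I"
  shows "hilbert_space (direct_power I H)"
proof -
  let ?D = "direct_power I H"
  have component: "x i \<in> carrier H" if "x \<in> carrier ?D" "i \<in> I" for x i using that by auto
  show ?thesis
  proof (intro hilbert_space.intro module_direct_power hilbert_space_axioms.intro)
    fix x y z assume "x \<in> carrier ?D" "y \<in> carrier ?D" "z \<in> carrier ?D"
    then show "inner_prod ?D (x \<oplus>\<^bsub>?D\<^esub> y) z = inner_prod ?D x z + inner_prod ?D y z"
      using component by (simp add: inner_prod_add_left sum.distrib)
  next
    fix c x y assume "x \<in> carrier ?D" "y \<in> carrier ?D"
    then show "inner_prod ?D (c \<odot>\<^bsub>?D\<^esub> x) y = c * inner_prod ?D x y"
      using component by (simp add: inner_prod_smult_left sum_distrib_left)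
  next
    fix x y assume xy: "x \<in> carrier ?D" "y \<in> carrier ?D"
    have "inner_prod H (y i) (x i) = cnj (inner_prod H (x i) (y i))" if "i \<in> I" for i
      by (rule inner_prod_commute[OF component[OF xy(1) that] component[OF xy(2) that]])
    then show "inner_prod ?D y x = cnj (inner_prod ?D x y)" by simp
  next
    fix x assume x: "x \<in> carrier ?D"
    have self: "inner_prod ?D x x = complex_of_real (\<Sum>i\<in>I. (hnorm H (x i))\<^sup>2)"
      using component[OF x] by (simp add: inner_prod_self)
    then show "inner_prod ?D x x \<in> \<real>\<^sub>\<ge>\<^sub>0"
      by (simp only: nonneg_Reals_of_real_iff) (simp add: sum_nonneg)
    assume "inner_prod ?D x x = 0"
    then have "(\<Sum>i\<in>I. (hnorm H (x i))\<^sup>2) = 0" using self by (metis of_real_eq_0_iff)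
    then have "\<forall>i\<in>I. hnorm H (x i) = 0" using assms by (simp add: sum_nonneg_eq_0_iff)
    then show "x = \<zero>\<^bsub>?D\<^esub>"
      using x component[OF x] by (intro direct_power_ext[of _ I]) (auto simp: hnorm_eq_0_iff)
  next
    fix f :: "nat \<Rightarrow> _"
    assume f: "\<And>n. f n \<in> carrier ?D"
      and Cauchy: "\<And>e. e > 0 \<Longrightarrow> \<exists>M::nat. \<forall>m\<ge>M. \<forall>n\<ge>M. hnorm ?D (f m \<ominus>\<^bsub>?D\<^esub> f n) < e"
    have "\<exists>y\<in>carrier H. (\<lambda>n. hnorm H (f n i \<ominus> y)) \<longlonglongrightarrow> 0" if i: "i \<in> I" for i
    proof (rule complete)
      fix e :: real assume "e > 0"
      then obtain M where M: "\<forall>m\<ge>M. \<forall>n\<ge>M. hnorm ?D (f m \<ominus>\<^bsub>?D\<^esub> f n) < e" using Cauchy by metis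
      have "hnorm H (f m i \<ominus> f n i) \<le> hnorm ?D (f m \<ominus>\<^bsub>?D\<^esub> f n)" for m n
        using hnorm_component_le[OF assms, of "f m \<ominus>\<^bsub>?D\<^esub> f n" i] f i component[OF f]
        by (simp add: minus_direct_power)
      then show "\<exists>M. \<forall>m\<ge>M. \<forall>n\<ge>M. hnorm H (f m i \<ominus> f n i) < e"
        using M by (meson order_le_less_trans)
    qed (use component[OF f i] in simp)
    then have "\<forall>i\<in>I. \<exists>y. y \<in> carrier H \<and> (\<lambda>n. hnorm H (f n i \<ominus> y)) \<longlonglongrightarrow> 0" by blast
    from bchoice[OF this] obtain y where y: "\<And>i. i \<in> I \<Longrightarrow> y i \<in> carrier H"
      "\<And>i. i \<in> I \<Longrightarrow> (\<lambda>n. hnorm H (f n i \<ominus> y i)) \<longlonglongrightarrow> 0" by auto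
    let ?y = "restrict y I"
    have y': "?y \<in> carrier ?D" using y(1) by auto
    have "(\<lambda>n. sqrt (\<Sum>i\<in>I. (hnorm H (f n i \<ominus> y i))\<^sup>2)) \<longlonglongrightarrow> sqrt (\<Sum>i\<in>I. 0\<^sup>2)"
      by (intro tendsto_intros y(2))
    moreover have "hnorm ?D (f n \<ominus>\<^bsub>?D\<^esub> ?y) = sqrt (\<Sum>i\<in>I. (hnorm H (f n i \<ominus> y i))\<^sup>2)" for n
      using f y' y(1) component[OF f] by (simp add: minus_direct_power hnorm_direct_power)
    ultimately have "(\<lambda>n. hnorm ?D (f n \<ominus>\<^bsub>?D\<^esub> ?y)) \<longlonglongrightarrow> 0" by simp
    then show "\<exists>x\<in>carrier ?D. (\<lambda>n. hnorm ?D (f n \<ominus>\<^bsub>?D\<^esub> x)) \<longlonglongrightarrow> 0" using y' by blast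
  qed
qed

text \<open>The blocks act on mutually orthogonal summands, so a common bound for the blocks bounds
  the whole operator without a factor depending on \<open>I\<close>. This sharpness is needed to
  locate the spectrum.\<close>

lemma diag_op_norm_le:
  assumes "finite I" and G: "\<And>i. i \<in> I \<Longrightarrow> G i \<in> bounded_op H H" and "0 \<le> b"
    and bound: "\<And>i x. i \<in> I \<Longrightarrow> x \<in> carrier H \<Longrightarrow> hnorm H (G i x) \<le> b * hnorm H x"
    and v: "v \<in> carrier (direct_power I H)"
  shows "hnorm (direct_power I H) (diag_op I H G v) \<le> b * hnorm (direct_power I H) v"
proof -
  have v': "v \<in> I \<rightarrow>\<^sub>E carrier H" using v by simp
  have closed: "v i \<in> carrier H" "G i (v i) \<in> carrier H" if "i \<in> I" for i
    using bounded_op_closed[OF G[OF that]] v' that by auto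
  have Gv: "diag_op I H G v \<in> I \<rightarrow>\<^sub>E carrier H" using v' closed(2) by (simp add: diag_op_def)
  have "(\<Sum>i\<in>I. (hnorm H (diag_op I H G v i))\<^sup>2) \<le> (\<Sum>i\<in>I. (b * hnorm H (v i))\<^sup>2)"
    using bound closed v' by (intro sum_mono power_mono) (auto simp: diag_op_apply)
  also have "\<dots> = b\<^sup>2 * (\<Sum>i\<in>I. (hnorm H (v i))\<^sup>2)"
    by (simp add: power_mult_distrib sum_distrib_left)
  finally have "sqrt (\<Sum>i\<in>I. (hnorm H (diag_op I H G v i))\<^sup>2)
      \<le> sqrt (b\<^sup>2 * (\<Sum>i\<in>I. (hnorm H (v i))\<^sup>2))" by (rule real_sqrt_le_mono)
  then show ?thesis
    using \<open>0 \<le> b\<close> v' Gv by (simp add: hnorm_direct_power real_sqrt_mult)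
qed

lemma diag_op_bounded:
  assumes "finite I" and G: "\<And>i. i \<in> I \<Longrightarrow> G i \<in> bounded_op H H"
  shows "diag_op I H G \<in> bounded_op (direct_power I H) (direct_power I H)"
proof -
  have "\<forall>i\<in>I. \<exists>b. b \<ge> 0 \<and> (\<forall>x\<in>carrier H. hnorm H (G i x) \<le> b * hnorm H x)"
    using bounded_op_bound[OF hilbert_space_axioms G] by metis
  from bchoice[OF this] obtain b where
    b: "\<And>i. i \<in> I \<Longrightarrow> b i \<ge> 0" "\<And>i x. i \<in> I \<Longrightarrow> x \<in> carrier H \<Longrightarrow> hnorm H (G i x) \<le> b i * hnorm H x"
    by auto
  \<comment> \<open>Mere boundedness is the goal here, so the sum of the block bounds is a
    convenient common bound.\<close>
  have bound: "hnorm H (G i x) \<le> sum b I * hnorm H x" if "i \<in> I" "x \<in> carrier H" for i x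
  proof -
    have "b i \<le> sum b I" using assms(1) b(1) that(1) by (intro member_le_sum) auto
    then have "b i * hnorm H x \<le> sum b I * hnorm H x" using that(2) by (intro mult_right_mono) simp_all
    with b(2)[OF that] show ?thesis by simp
  qed
  have closed: "G i (v i) \<in> carrier H" "v i \<in> carrier H" if "v \<in> I \<rightarrow>\<^sub>E carrier H" "i \<in> I" for v i
    using bounded_op_closed[OF G[OF that(2)]] that by auto
  show ?thesis
  proof (rule bounded_opI[where b = "sum b I"])
    fix v assume v: "v \<in> carrier (direct_power I H)"
    then show "diag_op I H G v \<in> carrier (direct_power I H)"
      using closed by (simp add: diag_op_def)
    show "hnorm (direct_power I H) (diag_op I H G v) \<le> sum b I * hnorm (direct_power I H) v"
      using assms(1) G b(1) bound v by (intro diag_op_norm_le sum_nonneg)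
    fix c
    show "diag_op I H G (c \<odot>\<^bsub>direct_power I H\<^esub> v) = c \<odot>\<^bsub>direct_power I H\<^esub> diag_op I H G v"
      using v closed by (auto simp: diag_op_def bounded_op_scale[OF G] intro!: restrict_ext)
  next
    fix v w assume "v \<in> carrier (direct_power I H)" "w \<in> carrier (direct_power I H)"
    then show "diag_op I H G (v \<oplus>\<^bsub>direct_power I H\<^esub> w) =
      diag_op I H G v \<oplus>\<^bsub>direct_power I H\<^esub> diag_op I H G w"
      using closed by (auto simp: diag_op_def bounded_op_add[OF G] intro!: restrict_ext)
  qed (simp add: diag_op_def)
qed

lemma selfadjoint_diag_op:
  assumes "finite I" and G: "\<And>i. i \<in> I \<Longrightarrow> selfadjoint_op H (G i)"
  shows "selfadjoint_op (direct_power I H) (diag_op I H G)"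
proof -
  interpret D: hilbert_space "direct_power I H" by (rule hilbert_space_direct_power[OF assms(1)])
  have "inner_prod H (G i (v i)) (w i) = inner_prod H (v i) (G i (w i))"
    if "v \<in> I \<rightarrow>\<^sub>E carrier H" "w \<in> I \<rightarrow>\<^sub>E carrier H" "i \<in> I" for v w i
    using G[OF that(3)] that by (auto simp: selfadjoint_op_iff PiE_mem)
  then have "inner_prod (direct_power I H) (diag_op I H G v) w =
      inner_prod (direct_power I H) v (diag_op I H G w)"
    if "v \<in> carrier (direct_power I H)" "w \<in> carrier (direct_power I H)" for v w
    using that by (simp add: diag_op_apply)
  moreover have "diag_op I H G \<in> bounded_op (direct_power I H) (direct_power I H)"
    using assms by (intro diag_op_bounded) (auto simp: selfadjoint_op_iff)
  ultimately show ?thesis unfolding D.selfadjoint_op_iff by blast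
qed

lemma diagonal_isometry:
  assumes "real (card I) * (cmod c)\<^sup>2 = 1"
  shows "(\<lambda>x\<in>carrier H. \<lambda>i\<in>I. c \<odot> x) \<in> isometry_op H (direct_power I H)"
    (is "?V \<in> _")
proof -
  have norm: "hnorm (direct_power I H) (?V x) = hnorm H x" if x: "x \<in> carrier H" for x
  proof -
    have Vx: "?V x = (\<lambda>i\<in>I. c \<odot> x)" using x by simp
    have "(\<lambda>i\<in>I. c \<odot> x) \<in> I \<rightarrow>\<^sub>E carrier H" using x by auto
    then have "hnorm (direct_power I H) (\<lambda>i\<in>I. c \<odot> x) = sqrt (real (card I) * (cmod c * hnorm H x)\<^sup>2)"
      using x by (simp add: hnorm_direct_power hnorm_scale)
    also have "real (card I) * (cmod c * hnorm H x)\<^sup>2 = (hnorm H x)\<^sup>2"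
      using assms by (simp add: power_mult_distrib flip: mult.assoc)
    finally show ?thesis using x by (simp only: Vx real_sqrt_abs abs_of_nonneg hnorm_nonneg)
  qed
  have "?V \<in> bounded_op H (direct_power I H)"
  proof (rule bounded_opI[where b = 1])
    fix k x assume "x \<in> carrier H"
    then show "?V (k \<odot> x) = k \<odot>\<^bsub>direct_power I H\<^esub> ?V x"
      using smult_assoc1[of c k x] smult_assoc1[of k c x] by (auto simp: mult.commute intro!: restrict_ext)
  next
    fix x y assume "x \<in> carrier H" "y \<in> carrier H"
    then show "?V (x \<oplus> y) = ?V x \<oplus>\<^bsub>direct_power I H\<^esub> ?V y"
      using smult_r_distr[of c x y] by (auto intro!: restrict_ext)
  next
    fix x assume "x \<in> carrier H"
    then show "hnorm (direct_power I H) (?V x) \<le> 1 * hnorm H x" by (simp only: norm)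
  qed auto
  then show ?thesis unfolding isometry_op_def using norm by blast
qed

lemma selfadjoint_op_scale:
  assumes "selfadjoint_op H T"
  shows "selfadjoint_op H (op_scale H (complex_of_real c) T)"
proof -
  have T: "T \<in> bounded_op H H"
    "\<And>x y. x \<in> carrier H \<Longrightarrow> y \<in> carrier H \<Longrightarrow> inner_prod H (T x) y = inner_prod H x (T y)"
    using assms by (simp_all add: selfadjoint_op_iff)
  show ?thesis
    unfolding selfadjoint_op_iff
    using op_scale_bounded[OF T(1)] bounded_op_closed[OF T(1)] T(2)
    by (simp add: inner_prod_smult_left inner_prod_smult_right)
qed

text \<open>The numerical radius estimate with bound 0, applied to S - T. It yields operator
  identities from information about quadratic forms alone.\<close>

lemma selfadjoint_op_eqI:
  assumes S: "selfadjoint_op H S" and T: "selfadjoint_op H T"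
    and form: "\<And>x. x \<in> carrier H \<Longrightarrow> Re (inner_prod H (S x) x) = Re (inner_prod H (T x) x)"
  shows "S = T"
proof -
  \<comment> \<open>The difference S - T as a linear combination indexed by the booleans with
    coefficients 1 and -1, so that self-adjointness comes from
    \<open>selfadjoint_op_lincomb\<close>.\<close>
  define A where "A b = (if b then S else T)" for b
  define g where "g b = (if b then 1 else -1 :: real)" for b
  define U where "U = op_lincomb H UNIV (\<lambda>b. complex_of_real (g b)) A"
  have A: "A b \<in> bounded_op H H" for b using S T by (simp add: A_def selfadjoint_op_iff)
  have U: "selfadjoint_op H U"
    unfolding U_def using S T by (intro selfadjoint_op_lincomb) (simp_all add: A_def)
  have inner: "inner_prod H (U x) z = inner_prod H (S x) z - inner_prod H (T x) z"
    if "x \<in> carrier H" "z \<in> carrier H" for x z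
    using that A unfolding U_def by (subst inner_prod_lincomb) (simp_all add: UNIV_bool A_def g_def)
  show ?thesis
  proof (rule bounded_op_eqI)
    show "S \<in> bounded_op H H" "T \<in> bounded_op H H" using S T by (simp_all add: selfadjoint_op_iff)
    fix x assume x: "x \<in> carrier H"
    have Ux: "U x \<in> carrier H" using U x by (simp add: selfadjoint_op_iff bounded_op_closed[of U H H])
    have "hnorm H (U x) \<le> 0 * hnorm H x"
      using form inner by (intro selfadjoint_norm_le_numerical_radius[OF U _ _ x]) simp_all
    then have "U x = \<zero>" using Ux hnorm_nonneg[OF Ux] by (simp add: hnorm_eq_0_iff)
    then have "inner_prod H (S x) z = inner_prod H (T x) z" if "z \<in> carrier H" for z
      using inner[OF x that] that by simp
    then show "S x = T x"
      using bounded_op_closed[OF A x, of True] bounded_op_closed[OF A x, of False]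
      by (intro inner_prod_ext) (simp_all add: A_def)
  qed
qed

end

section \<open>Auerbach bases\<close>

lemma compact_rows:
  fixes K :: "(real ^ 'd::finite) set"
  assumes "compact K"
  shows "compact {M :: real ^ 'd ^ 'd. \<forall>i. M $ i \<in> K}"
proof -
  obtain B where B: "\<And>x. x \<in> K \<Longrightarrow> norm x \<le> B"
    using compact_imp_bounded[OF assms] by (auto simp: bounded_iff)
  \<comment> \<open>The norm of a matrix is at most the sum of the norms of its rows.\<close>
  have "norm M \<le> real CARD('d) * B" if "\<forall>i. M $ i \<in> K" for M :: "real ^ 'd ^ 'd"
  proof -
    have "norm M \<le> (\<Sum>i\<in>UNIV. norm (M $ i))"
      by (simp add: norm_vec_def L2_set_le_sum)
    also have "\<dots> \<le> (\<Sum>i\<in>(UNIV :: 'd set). B)"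
      using B that by (intro sum_mono) auto
    finally show ?thesis by simp
  qed
  then have "bounded {M :: real ^ 'd ^ 'd. \<forall>i. M $ i \<in> K}"
    by (auto simp: bounded_iff)
  moreover have "closed {M :: real ^ 'd ^ 'd. M $ i \<in> K}" for i
    using continuous_closed_vimage[OF compact_imp_closed[OF assms], of "\<lambda>M. M $ i"]
    by (simp add: vimage_def)
  then have "closed {M :: real ^ 'd ^ 'd. \<forall>i. M $ i \<in> K}"
    by (rule closed_Collect_all)
  ultimately show ?thesis
    by (simp add: compact_eq_bounded_closed)
qed

text \<open>A basis chosen inside \<open>K\<close> supplies the rows. This ensures that the maximal
  determinant below is nonzero.\<close>

lemma det_nonzero_of_spanning:
  fixes K :: "(real ^ 'd::finite) set"
  assumes "span K = UNIV"
  obtains M :: "real ^ 'd ^ 'd" where "\<And>i. M $ i \<in> K" "det M \<noteq> 0"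
proof -
  obtain B where B: "B \<subseteq> K" "independent B" "K \<subseteq> span B"
    using maximal_independent_subset by blast
  have "span B = UNIV"
    using B assms by (metis UNIV_eq_I span_mono span_span subset_UNIV subset_antisym)
  have "card B = CARD('d)"
    using dim_span_eq_card_independent[OF B(2)] \<open>span B = UNIV\<close> by (simp add: dim_UNIV)
  moreover have "finite B" using B(2) by (rule independent_imp_finite)
  ultimately obtain h where h: "bij_betw h (UNIV :: 'd set) B"
    using finite_same_card_bij[of "UNIV :: 'd set" B] by auto
  define M :: "real ^ 'd ^ 'd" where "M = (\<chi> i. h i)"
  have "det M \<noteq> 0"
  proof
    assume "det M = 0"
    then have "\<not> (\<forall>c. (\<Sum>i\<in>UNIV. c i *s row i M) = 0 \<longrightarrow> (\<forall>i. c i = 0))"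
      using invertible_det_nz[of M] unfolding invertible_right_inverse matrix_right_invertible_independent_rows
      by blast
    then obtain c i where c: "(\<Sum>i\<in>UNIV. c i *s row i M) = 0" "c i \<noteq> 0" by blast
    have "(\<Sum>i\<in>UNIV. c i *\<^sub>R h i) = 0"
      using c(1) by (simp add: row_def M_def scalar_mult_eq_scaleR)
    \<comment> \<open>The row relation, reindexed along the bijection \<open>h\<close>, becomes a
      nontrivial relation in the independent set \<open>B\<close>.\<close>
    then have "(\<Sum>v\<in>B. c (inv_into UNIV h v) *\<^sub>R v) = 0"
      using h sum.reindex_bij_betw[OF h, of "\<lambda>v. c (inv_into UNIV h v) *\<^sub>R v"]
      by (simp add: bij_betw_def)
    then have "c (inv_into UNIV h (h i)) = 0"
      using independentD[OF B(2) \<open>finite B\<close> order_refl, of "\<lambda>v. c (inv_into UNIV h v)" "h i"] h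
      by (auto simp: bij_betw_def)
    with h c(2) show False by (simp add: bij_betw_def)
  qed
  moreover have "M $ i \<in> K" for i using h B(1) by (auto simp: M_def bij_betw_def)
  ultimately show ?thesis using that by blast
qed

text \<open>Choose \<open>E\<close> with rows in \<open>K\<close> and |det E| maximal. By Cramer's
  rule the i-th coordinate of \<open>x\<close> is the factor by which the determinant changes when
  row i is replaced by \<open>x\<close>; for x in \<open>K\<close> maximality bounds it by
  1.\<close>

lemma auerbach_basis_spanning:
  fixes K :: "(real ^ 'd::finite) set"
  assumes "compact K" and "span K = UNIV"
  shows "\<exists>e f :: 'd \<Rightarrow> real ^ 'd. (\<forall>i. e i \<in> K) \<and> (\<forall>i. \<forall>x\<in>K. \<bar>f i \<bullet> x\<bar> \<le> 1) \<and>
    (\<forall>x. (\<Sum>i\<in>UNIV. (f i \<bullet> x) *\<^sub>R e i) = x)"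
proof -
  define S where "S = {M :: real ^ 'd ^ 'd. \<forall>i. M $ i \<in> K}"
  have S: "M \<in> S \<longleftrightarrow> (\<forall>i. M $ i \<in> K)" for M by (simp add: S_def)
  obtain M0 where M0: "M0 \<in> S" "det M0 \<noteq> 0"
    using det_nonzero_of_spanning[OF assms(2)] S by metis
  have "continuous_on S (\<lambda>M. \<bar>det M\<bar>)"
    unfolding det_def by (intro continuous_intros)
  moreover have "compact S" unfolding S_def by (rule compact_rows[OF assms(1)])
  moreover have "S \<noteq> {}" using M0(1) by blast
  ultimately obtain E where "E \<in> S" "\<forall>M\<in>S. \<bar>det M\<bar> \<le> \<bar>det E\<bar>"
    using continuous_attains_sup by blast
  then have E: "E \<in> S" "\<And>M. M \<in> S \<Longrightarrow> \<bar>det M\<bar> \<le> \<bar>det E\<bar>" by blast+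
  have nz: "det E \<noteq> 0" using E(2)[OF M0(1)] M0(2) by auto
  then obtain B where B: "B ** E = mat 1"
    by (metis invertible_det_nz invertible_left_inverse)
  \<comment> \<open>The columns of the inverse matrix form the basis dual to the rows of
    \<open>E\<close>.\<close>
  define f where "f i = column i (B)" for i
  have f: "f i \<bullet> x = (x v* B) $ i" for i x
    by (simp add: f_def column_def vector_matrix_mult_def inner_vec_def mult.commute)
  have expand: "(\<Sum>i\<in>UNIV. (f i \<bullet> x) *s row i E) = x" for x
  proof -
    have "(\<Sum>i\<in>UNIV. (f i \<bullet> x) *s row i E) = (x v* B) v* E"
      by (simp add: vec_eq_iff f row_def vector_matrix_mult_def mult.commute)
    also have "\<dots> = x"
      by (simp add: vector_matrix_mul_assoc B)
    finally show ?thesis .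
  qed
  have "\<bar>f i \<bullet> x\<bar> \<le> 1" if "x \<in> K" for i x
  proof -
    have "det (\<chi> j. if j = i then x else row j E) = (f i \<bullet> x) * det E"
      using cramer_lemma_transpose[of i "\<chi> i. f i \<bullet> x" E]
      by (simp only: vec_lambda_beta expand)
    moreover have "(\<chi> j. if j = i then x else row j E) \<in> S"
      using E(1) that by (simp add: S row_def)
    ultimately have "\<bar>f i \<bullet> x\<bar> * \<bar>det E\<bar> \<le> \<bar>det E\<bar>"
      using E(2) by (metis abs_mult)
    then show ?thesis using nz by simp
  qed
  moreover have "row i E \<in> K" for i using E(1) by (simp add: S row_def)
  ultimately show ?thesis
    using expand by (intro exI[of _ "\<lambda>i. row i E"] exI[of _ f]) (simp add: scalar_mult_eq_scaleR)
qed

text \<open>If \<open>K\<close> does not span, an Auerbach basis of the sum of \<open>K\<close> and the unit ball of its orthogonal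
  complement is projected back to the span of \<open>K\<close>.\<close>

lemma auerbach_basis:
  fixes K :: "(real ^ 'd::finite) set"
  assumes "compact K" and "K \<noteq> {}"
  obtains e f :: "'d \<Rightarrow> real ^ 'd" where "\<And>i. e i \<in> K"
    and "\<And>i x. x \<in> K \<Longrightarrow> \<bar>f i \<bullet> x\<bar> \<le> 1"
    and "\<And>x. x \<in> K \<Longrightarrow> (\<Sum>i\<in>UNIV. (f i \<bullet> x) *\<^sub>R e i) = x"
proof -
  define P where "P = {w. \<forall>x\<in>span K. orthogonal x w}"
  define W where "W = P \<inter> cball 0 1"
  define K' where "K' = {k + w | k w. k \<in> K \<and> w \<in> W}"
  have P: "subspace P" unfolding P_def by (rule subspace_orthogonal_to_vectors)
  have "compact W" unfolding W_def by (intro closed_Int_compact closed_subspace P compact_cball)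
  then have compact: "compact K'" unfolding K'_def by (rule compact_sums[OF assms(1)])
  \<comment> \<open>This inclusion lets the functionals found for \<open>K'\<close> be kept
    unchanged: their bounds hold on \<open>K\<close> as well. Only the vectors \<open>e'\<close>
    have to be replaced.\<close>
  have sub: "K \<subseteq> K'"
  proof
    fix k assume "k \<in> K"
    moreover have "0 \<in> W" using subspace_0[OF P] by (simp add: W_def)
    moreover have "k = k + 0" by simp
    ultimately show "k \<in> K'" unfolding K'_def by blast
  qed
  \<comment> \<open>A base point: unit normal directions lie in \<open>span K'\<close> as
    differences of k0 + sgn z and k0, both in \<open>K'\<close>.\<close>
  obtain k0 where k0: "k0 \<in> K" using assms(2) by (metis ex_in_conv)
  have "x \<in> span K'" for x
  proof -
    obtain y z where yz: "y \<in> span K" "x = y + z" and "\<And>w. w \<in> span K \<Longrightarrow> orthogonal z w"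
      by (rule orthogonal_subspace_decomp_exists[of K x]) (rule that; blast)
    then have z: "z \<in> P" by (simp add: P_def orthogonal_commute)
    have "sgn z \<in> W"
      using subspace_scale[OF P z, of "inverse (norm z)"] 
      by (simp add: W_def norm_sgn sgn_div_norm[symmetric])
    then have "k0 + sgn z \<in> K'" using k0 unfolding K'_def by blast
    then have "(k0 + sgn z) - k0 \<in> span K'"
      using sub k0 by (meson span_base span_diff subsetD)
    then have "norm z *\<^sub>R sgn z \<in> span K'" by (simp add: span_scale)
    then have "z \<in> span K'" by (cases "z = 0") (simp_all add: sgn_div_norm span_zero)
    moreover have "y \<in> span K'" using yz(1) span_mono[OF sub] by blast
    ultimately show ?thesis unfolding yz(2) by (rule span_add[rotated])
  qed
  then have "span K' = UNIV" by auto
  from auerbach_basis_spanning[OF compact this] obtain e' f :: "'d \<Rightarrow> real ^ 'd" where e': "\<And>i. e' i \<in> K'"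
    and f: "\<And>i x. x \<in> K' \<Longrightarrow> \<bar>f i \<bullet> x\<bar> \<le> 1"
    and ef: "\<And>x. (\<Sum>i\<in>UNIV. (f i \<bullet> x) *\<^sub>R e' i) = x"
    by blast
  have "\<forall>i. \<exists>k w. e' i = k + w \<and> k \<in> K \<and> w \<in> W" using e' unfolding K'_def by blast
  then obtain e w where "\<forall>i. e' i = e i + w i \<and> e i \<in> K \<and> w i \<in> W" by metis
  then have ew: "\<And>i. e' i = e i + w i" "\<And>i. e i \<in> K" "\<And>i. w i \<in> P" by (auto simp: W_def)
  have "(\<Sum>i\<in>UNIV. (f i \<bullet> x) *\<^sub>R e i) = x" if "x \<in> K" for x
  proof -
    let ?e = "\<Sum>i\<in>UNIV. (f i \<bullet> x) *\<^sub>R e i" and ?w = "\<Sum>i\<in>UNIV. (f i \<bullet> x) *\<^sub>R w i"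
    \<comment> \<open>The error x - ?e lies in the span of \<open>K\<close> and, being ?w, also in
      its orthogonal complement, so it is zero.\<close>
    have eq: "?w = x - ?e"
      using ef[of x] by (simp add: ew(1) scaleR_add_right sum.distrib algebra_simps)
    have "?w \<in> P" using ew(3) by (intro subspace_sum[OF P] subspace_scale[OF P])
    moreover have "x - ?e \<in> span K"
      using ew(2) that by (intro span_diff span_sum span_scale span_base)
    ultimately have "orthogonal ?w ?w" using eq by (simp add: P_def)
    then show ?thesis using eq by (simp add: orthogonal_self)
  qed
  then show ?thesis by (intro that[of e f] ew(2) f subsetD[OF sub])
qed

section \<open>The dilation\<close>

lemma inj_complex_vec: "inj complex_vec"
  by (rule injI) (simp add: complex_vec_def vec_eq_iff)

section \<open>Construction of the dilation and location of its joint spectrum\<close>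

context hilbert_space
begin

lemma selfadjoint_normal_tuple:
  assumes "\<And>i. selfadjoint_op H (N i)"
    and "\<And>i j x. x \<in> carrier H \<Longrightarrow> N i (N j x) = N j (N i x)"
  shows "normal_tuple H N"
proof -
  have N: "N i \<in> bounded_op H H" "adjoint_op H H (N i) = N i" for i
    using assms(1)[of i] by (simp_all add: selfadjoint_op_def)
  have "op_comp H (N i) (N j) = op_comp H (N j) (N i)" for i j
    using assms(2) by (intro bounded_op_eqI[of _ H H] op_comp_bounded N) simp_all
  then show ?thesis by (simp add: normal_tuple_def normal_op_def N)
qed

text \<open>On the zero space 0 * id = id, so a character would satisfy \<phi> (id) = 0, against
  \<phi> (id) = 1. This settles empty \<open>K\<close>, where the spectrum must be empty.\<close>

lemma joint_spectrum_trivial: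
  assumes "carrier H = {\<zero>}" and "\<And>i. N i \<in> bounded_op H H"
  shows "joint_spectrum H N = {}"
proof -
  have \<A>: "unital_cstar_subalgebra H (cstar_generated H N)"
    using assms(2) by (intro cstar_generated_subalgebra) auto
  have "\<not> character_on H (cstar_generated H N) \<phi>" for \<phi>
  proof
    assume \<phi>: "character_on H (cstar_generated H N) \<phi>"
    have id: "op_id H \<in> cstar_generated H N" by (rule unital_cstar_subalgebraD(2)[OF \<A>])
    have "op_scale H 0 (op_id H) = op_id H"
      by (intro bounded_op_eqI[of _ H H] op_scale_bounded op_id_bounded) (simp add: assms(1))
    then have "\<phi> (op_id H) = 0 * \<phi> (op_id H)"
      using \<phi> id unfolding character_on_def linear_functional_on_def by metis
    then show False using character_id[OF \<A> \<phi>] by simp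
  qed
  then show ?thesis by (simp add: joint_spectrum_def)
qed

text \<open>\<open>K\<close> is kept out: the assumptions are the Auerbach properties on the joint
  quadratic form of \<open>A\<close>, and the spectral conclusion is the dual description of the
  absolutely convex hull of the points n e_i, with n = card I. Thus e = f = 0 can also be used when
  the form vanishes.\<close>

lemma direct_sum_dilation:
  fixes A :: "'d::finite \<Rightarrow> 'a \<Rightarrow> 'a" and e f :: "'i \<Rightarrow> real ^ 'd"
  assumes I: "finite I" "I \<noteq> {}"
    and A: "\<And>j. selfadjoint_op H (A j)"
    and contr: "\<And>i x. i \<in> I \<Longrightarrow> x \<in> carrier H \<Longrightarrow>
      \<bar>f i \<bullet> (\<chi> j. Re (inner_prod H (A j x) x))\<bar> \<le> (hnorm H x)\<^sup>2"
    and expand: "\<And>x. x \<in> carrier H \<Longrightarrow>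
      (\<Sum>i\<in>I. (f i \<bullet> (\<chi> j. Re (inner_prod H (A j x) x))) *\<^sub>R e i) = (\<chi> j. Re (inner_prod H (A j x) x))"
  shows "\<exists>N. normal_tuple (direct_power I H) N \<and> is_dilation H A (direct_power I H) N \<and>
    (\<forall>v\<in>joint_spectrum (direct_power I H) N. \<exists>w. v = complex_vec w \<and>
      (\<forall>g \<beta>. (\<forall>i\<in>I. \<bar>real (card I) * (g \<bullet> e i)\<bar> \<le> \<beta>) \<longrightarrow> \<bar>g \<bullet> w\<bar> \<le> \<beta>))"
proof -
  let ?D = "direct_power I H"
  interpret D: hilbert_space ?D by (rule hilbert_space_direct_power[OF I(1)])
  interpret HD: hilbert_space_pair H ?D by unfold_locales
  define n where "n = real (card I)"
  have n: "n > 0" using I by (simp add: n_def card_gt_0_iff)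
  define F where "F i = op_lincomb H UNIV (\<lambda>j. complex_of_real (f i $ j)) A" for i
  \<comment> \<open>The factor \<open>n\<close> compensates for the weight 1 / n that the
    compression puts on each block.\<close>
  define c where "c i j = n * e i $ j" for i j
  define N where "N j = diag_op I H (\<lambda>i. op_scale H (complex_of_real (c i j)) (F i))" for j
  have A': "A j \<in> bounded_op H H" for j using A by (simp add: selfadjoint_op_iff)
  have F: "selfadjoint_op H (F i)" for i
    unfolding F_def using A by (intro selfadjoint_op_lincomb) simp_all
  then have F': "F i \<in> bounded_op H H" for i by (simp add: selfadjoint_op_iff)
  have cF: "op_scale H (complex_of_real r) (F i) \<in> bounded_op H H" for r i
    by (rule op_scale_bounded[OF F'])
  have F_form: "Re (inner_prod H (F i x) x) = f i \<bullet> (\<chi> j. Re (inner_prod H (A j x) x))"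
    if "x \<in> carrier H" for i x
    using that A' by (simp add: F_def inner_prod_lincomb inner_vec_def)
  \<comment> \<open>The form of \<open>F i\<close> is f_i of the joint form of \<open>A\<close>,
    which \<open>contr\<close> bounds by |x|^2; self-adjointness upgrades this to the norm.\<close>
  have F_contr: "hnorm H (F i x) \<le> 1 * hnorm H x" if "i \<in> I" "x \<in> carrier H" for i x
    using contr[OF that(1)] F_form that(2)
    by (intro selfadjoint_norm_le_numerical_radius[OF F]) simp_all
  have N: "selfadjoint_op ?D (N j)" for j
    unfolding N_def by (intro selfadjoint_diag_op I selfadjoint_op_scale F)
  then have N': "N j \<in> bounded_op ?D ?D" for j by (simp add: D.selfadjoint_op_iff)
  have N_apply: "N j v i = complex_of_real (c i j) \<odot> F i (v i)"
    if "v \<in> I \<rightarrow>\<^sub>E carrier H" "i \<in> I" for v i j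
  proof -
    have "v i \<in> carrier H" using that by auto
    then show ?thesis using that by (simp add: N_def diag_op_apply)
  qed
  have N_closed: "N j v \<in> I \<rightarrow>\<^sub>E carrier H" if "v \<in> I \<rightarrow>\<^sub>E carrier H" for v j
    using bounded_op_closed[OF N'] that by simp

  have normal: "normal_tuple ?D N"
  proof (rule D.selfadjoint_normal_tuple[OF N])
    fix j k v assume "v \<in> carrier ?D"
    then have v: "v \<in> I \<rightarrow>\<^sub>E carrier H" by simp
    \<comment> \<open>In block i every \<open>N j\<close> is a scalar multiple of the same operator
      \<open>F i\<close>.\<close>
    show "N j (N k v) = N k (N j v)"
    proof (rule direct_power_ext[OF N_closed[OF N_closed[OF v]] N_closed[OF N_closed[OF v]]])
      fix i assume i: "i \<in> I"
      have "v i \<in> carrier H" using v i by auto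
      then show "N j (N k v) i = N k (N j v) i"
        using smult_assoc1[of "complex_of_real (c i j)" "complex_of_real (c i k)"]
          smult_assoc1[of "complex_of_real (c i k)" "complex_of_real (c i j)"]
          i v N_closed bounded_op_closed[OF F']
        by (simp add: N_apply bounded_op_scale[OF F'] mult.commute)
    qed
  qed

  have dilation: "is_dilation H A ?D N"
  proof -
    \<comment> \<open>Each of the \<open>n\<close> copies of \<open>x\<close> gets weight 1 / sqrt
      n, so that the embedding is isometric; the product s s = 1 / n is the averaging
      weight.\<close>
    define s where "s = complex_of_real (1 / sqrt n)"
    have s: "cmod s = 1 / sqrt n" "cnj s = s" "s * s = complex_of_real (1 / n)"
      using n by (simp_all add: s_def norm_divide flip: of_real_mult)
    define V where "V = (\<lambda>x\<in>carrier H. \<lambda>i\<in>I. s \<odot> x)"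
    have V: "V \<in> isometry_op H ?D"
      unfolding V_def using n by (intro diagonal_isometry) (simp add: s power_divide n_def)
    then have V': "V \<in> bounded_op H ?D" by (simp add: isometry_op_def)
    have V_apply: "V x i = s \<odot> x" if "x \<in> carrier H" "i \<in> I" for x i using that by (simp add: V_def)
    have V_closed: "V x \<in> I \<rightarrow>\<^sub>E carrier H" if "x \<in> carrier H" for x
      using bounded_op_closed[OF V' that] by simp
    \<comment> \<open>The assumption \<open>expand\<close> gives equality of quadratic forms only;
      both sides are self-adjoint, which suffices.\<close>
    have A_eq: "A j = op_lincomb H I (\<lambda>i. complex_of_real (e i $ j)) F" for j
    proof (rule selfadjoint_op_eqI[OF A selfadjoint_op_lincomb[OF I(1) F]])
      fix x assume x: "x \<in> carrier H"
      have "Re (inner_prod H (op_lincomb H I (\<lambda>i. complex_of_real (e i $ j)) F x) x) =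
        (\<Sum>i\<in>I. (f i \<bullet> (\<chi> j. Re (inner_prod H (A j x) x))) *\<^sub>R e i) $ j"
        using x F' I(1) by (simp add: inner_prod_lincomb F_form mult.commute)
      also have "\<dots> = Re (inner_prod H (A j x) x)" by (subst expand[OF x]) simp
      finally show "Re (inner_prod H (A j x) x) =
        Re (inner_prod H (op_lincomb H I (\<lambda>i. complex_of_real (e i $ j)) F x) x)" by simp
    qed
    have "A j x = adjoint_op H ?D V (N j (V x))" if x: "x \<in> carrier H" for j x
    proof (rule inner_prod_ext)
      have NV: "N j (V x) \<in> carrier ?D" using N_closed[OF V_closed[OF x]] by simp
      show "adjoint_op H ?D V (N j (V x)) \<in> carrier H"
        by (rule bounded_op_closed[OF HD.adjoint_op_closed[OF V'] NV])
      fix z assume z: "z \<in> carrier H"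
      have "inner_prod H (adjoint_op H ?D V (N j (V x))) z = inner_prod ?D (N j (V x)) (V z)"
        by (rule HD.inner_prod_adjoint(2)[OF V' z NV])
      \<comment> \<open>Block i contributes c i j / n = e i $ j times <F i x, z>.\<close>
      also have "\<dots> = (\<Sum>i\<in>I. complex_of_real (e i $ j) * inner_prod H (F i x) z)"
        unfolding direct_power_simps
      proof (rule sum.cong)
        fix i assume i: "i \<in> I"
        have Fx: "F i x \<in> carrier H" by (rule bounded_op_closed[OF F' x])
        have "inner_prod H (N j (V x) i) (V z i) =
          complex_of_real (c i j) * ((s * s) * inner_prod H (F i x) z)"
          using x z i Fx V_closed[OF x] s(2)
          by (simp add: N_apply V_apply bounded_op_scale[OF F'] inner_prod_smult_left inner_prod_smult_right)
        also have "\<dots> = complex_of_real (e i $ j) * inner_prod H (F i x) z"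
          using n by (simp add: s(3) c_def)
        finally show "inner_prod H (N j (V x) i) (V z i) =
          complex_of_real (e i $ j) * inner_prod H (F i x) z" .
      qed simp
      also have "\<dots> = inner_prod H (A j x) z"
        by (subst A_eq) (rule inner_prod_lincomb[OF I(1) F' x z, symmetric])
      finally show "inner_prod H (A j x) z = inner_prod H (adjoint_op H ?D V (N j (V x))) z" by simp
    qed (rule bounded_op_closed[OF A' x])
    moreover have "A j \<in> extensional (carrier H)" for j
      using A'[of j] by (simp only: bounded_op_def PiE_def mem_Collect_eq Int_iff)
    ultimately have "A j = compose (carrier H) (adjoint_op H ?D V) (compose (carrier H) (N j) V)" for j
      by (intro extensionalityI[where A = "carrier H"]) (simp_all add: compose_def)
    then show ?thesis unfolding is_dilation_def using V by blast
  qed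

  have "\<exists>w. v = complex_vec w \<and>
      (\<forall>g \<beta>. (\<forall>i\<in>I. \<bar>real (card I) * (g \<bullet> e i)\<bar> \<le> \<beta>) \<longrightarrow> \<bar>g \<bullet> w\<bar> \<le> \<beta>)"
    if v: "v \<in> joint_spectrum ?D N" for v
  proof -
    let ?\<A> = "cstar_generated ?D N"
    obtain \<phi> where \<phi>: "character_on ?D ?\<A> \<phi>" "v = (\<chi> j. \<phi> (N j))"
      using v unfolding joint_spectrum_def by blast
    have \<A>: "unital_cstar_subalgebra ?D ?\<A>"
      using N' by (intro D.cstar_generated_subalgebra) auto
    have N\<A>: "N j \<in> ?\<A>" for j by (rule D.generator_in_cstar_generated)
    have Im: "Im (\<phi> (N j)) = 0" for j
    proof -
      obtain b where "0 \<le> b" "\<And>x. x \<in> carrier ?D \<Longrightarrow> hnorm ?D (N j x) \<le> b * hnorm ?D x"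
        using bounded_op_bound[OF D.hilbert_space_axioms N'] by metis
      then show ?thesis by (rule D.character_selfadjoint(1)[OF \<A> \<phi>(1) N\<A> N])
    qed
    define w :: "real ^ 'd" where "w = (\<chi> j. Re (\<phi> (N j)))"
    have v_eq: "v = complex_vec w" by (simp add: \<phi>(2) w_def complex_vec_def vec_eq_iff complex_eq_iff Im)
    have w_bound: "\<bar>g \<bullet> w\<bar> \<le> \<beta>" if \<beta>: "\<forall>i\<in>I. \<bar>real (card I) * (g \<bullet> e i)\<bar> \<le> \<beta>" for g \<beta>
    proof -
      \<comment> \<open>This is g . N. Its i-th block is n (g . e_i) F_i, of norm at most \<beta>
        since \<open>F i\<close> is a contraction, so a character has modulus at most \<beta> on it;
        its value there is g . w.\<close>
      define T where "T = op_lincomb ?D UNIV (\<lambda>j. complex_of_real (g $ j)) N"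
      define G where "G i = op_scale H (complex_of_real (n * (g \<bullet> e i))) (F i)" for i
      have T: "T \<in> ?\<A>" "\<phi> T = (\<Sum>j\<in>UNIV. complex_of_real (g $ j) * \<phi> (N j))"
        unfolding T_def using \<phi>(1)
        by (auto simp: character_on_def intro!: D.op_lincomb_closed[OF \<A> finite_class.finite_UNIV] N\<A>)
      have T_sa: "selfadjoint_op ?D T"
        unfolding T_def by (intro D.selfadjoint_op_lincomb N) simp_all
      have T': "T \<in> bounded_op ?D ?D" by (rule D.unital_cstar_subalgebraD(1)[OF \<A> T(1)])
      have G: "diag_op I H G \<in> bounded_op ?D ?D"
        unfolding G_def by (intro diag_op_bounded I cF)
      have "T x = diag_op I H G x" if x: "x \<in> carrier ?D" for x
      proof (rule D.inner_prod_ext)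
        fix z assume z: "z \<in> carrier ?D"
        have comp: "x i \<in> carrier H" "z i \<in> carrier H" "F i (x i) \<in> carrier H" if "i \<in> I" for i
          using x z that bounded_op_closed[OF F', of "x i" i] by auto
        have "inner_prod ?D (T x) z = (\<Sum>j\<in>UNIV. complex_of_real (g $ j) * inner_prod ?D (N j x) z)"
          unfolding T_def by (rule D.inner_prod_lincomb[OF finite_class.finite_UNIV N' x z])
        also have "\<dots> = (\<Sum>j\<in>UNIV. \<Sum>i\<in>I. complex_of_real (n * (g $ j * e i $ j)) * inner_prod H (F i (x i)) (z i))"
          using x comp by (simp add: N_apply inner_prod_smult_left sum_distrib_left c_def mult_ac)
        also have "\<dots> = (\<Sum>i\<in>I. \<Sum>j\<in>UNIV. complex_of_real (n * (g $ j * e i $ j)) * inner_prod H (F i (x i)) (z i))"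
          by (rule sum.swap)
        also have "\<dots> = (\<Sum>i\<in>I. complex_of_real (n * (g \<bullet> e i)) * inner_prod H (F i (x i)) (z i))"
          by (simp add: inner_vec_def sum_distrib_left sum_distrib_right mult.assoc)
        also have "\<dots> = inner_prod ?D (diag_op I H G x) z"
          using x comp by (simp add: diag_op_apply G_def inner_prod_smult_left)
        finally show "inner_prod ?D (T x) z = inner_prod ?D (diag_op I H G x) z" .
      qed (use bounded_op_closed[OF T' x] bounded_op_closed[OF G x] in simp_all)
      \<comment> \<open>\<beta> dominates an absolute value because \<open>I\<close> is
        non-empty.\<close>
      moreover have "0 \<le> \<beta>"
      proof -
        obtain i where "i \<in> I" using I(2) by (metis ex_in_conv)
        with \<beta> show ?thesis using abs_ge_zero[of "real (card I) * (g \<bullet> e i)"] by force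
      qed
      moreover have "hnorm H (G i x) \<le> \<beta> * hnorm H x" if i: "i \<in> I" and x: "x \<in> carrier H" for i x
      proof -
        have Fx: "F i x \<in> carrier H" by (rule bounded_op_closed[OF F' x])
        have "hnorm H (G i x) = \<bar>n * (g \<bullet> e i)\<bar> * hnorm H (F i x)"
          unfolding G_def using x Fx by (simp only: op_simps hnorm_scale norm_of_real)
        also have "\<dots> \<le> \<beta> * hnorm H x"
          using \<beta> i F_contr[OF i x] Fx \<open>0 \<le> \<beta>\<close> by (intro mult_mono) (simp_all add: n_def)
        finally show ?thesis .
      qed
      ultimately have bound: "hnorm ?D (T x) \<le> \<beta> * hnorm ?D x" if "x \<in> carrier ?D" for x
        using diag_op_norm_le[OF I(1), of G \<beta> x] that cF by (simp only: G_def)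
      have "\<bar>Re (\<phi> T)\<bar> \<le> \<beta>"
        by (rule D.character_selfadjoint(2)[OF \<A> \<phi>(1) T(1) T_sa \<open>0 \<le> \<beta>\<close> bound])
      moreover have "Re (\<phi> T) = g \<bullet> w"
        by (simp add: T(2) w_def inner_vec_def)
      ultimately show ?thesis by simp
    qed
    show ?thesis by (intro exI[of _ w] conjI allI impI v_eq w_bound)
  qed
  then show ?thesis by (intro exI[of _ N] conjI ballI normal dilation)
qed

lemma numerical_range_in_W1:
  fixes A :: "'d::finite \<Rightarrow> 'a \<Rightarrow> 'a"
  assumes "\<And>j. selfadjoint_op H (A j)" "x \<in> carrier H" "hnorm H x = 1"
  shows "complex_vec (\<chi> j. Re (inner_prod H (A j x) x)) \<in> W1 H A"
proof -
  have "range A \<subseteq> bounded_op H H" using assms(1) by (auto simp: selfadjoint_op_iff)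
  from vector_state[OF cstar_generated_subalgebra[OF this] assms(2,3)]
  have "(\<chi> j. inner_prod H (A j x) x) \<in> W1 H A" unfolding W1_def
    by (intro CollectI exI[of _ "\<lambda>T. inner_prod H (T x) x"] conjI refl)
  moreover have "complex_vec (\<chi> j. Re (inner_prod H (A j x) x)) = (\<chi> j. inner_prod H (A j x) x)"
    using selfadjoint_inner_real[OF assms(1,2)] by (simp add: complex_vec_def vec_eq_iff)
  ultimately show ?thesis by simp
qed

text \<open>The joint quadratic form scales with the square of |x|, so normalising \<open>x\<close>
  reduces the claim to the unit vectors covered by \<open>W1\<close>.\<close>

lemma numerical_range_scaled:
  fixes A :: "'d::finite \<Rightarrow> 'a \<Rightarrow> 'a"
  assumes A: "\<And>j. selfadjoint_op H (A j)" and W1: "W1 H A \<subseteq> complex_vec ` K"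
    and x: "x \<in> carrier H" "x \<noteq> \<zero>"
  shows "\<exists>k\<in>K. (\<chi> j. Re (inner_prod H (A j x) x)) = (hnorm H x)\<^sup>2 *\<^sub>R k"
proof -
  define c where "c = complex_of_real (1 / hnorm H x)"
  have nz: "hnorm H x \<noteq> 0" using x by (simp add: hnorm_eq_0_iff)
  have c: "cmod c * hnorm H x = 1" "c * cnj c = complex_of_real (1 / (hnorm H x)\<^sup>2)"
    using nz x(1) by (simp_all add: c_def norm_divide power2_eq_square)
  define k where "k = (\<chi> j. Re (inner_prod H (A j (c \<odot> x)) (c \<odot> x)))"
  have "complex_vec k \<in> complex_vec ` K"
    using numerical_range_in_W1[where A = A, OF A, of "c \<odot> x"] W1 x(1) c(1) by (auto simp: k_def hnorm_scale)
  then have "k \<in> K" by (simp add: inj_image_mem_iff[OF inj_complex_vec])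
  moreover have "Re (inner_prod H (A j x) x) = (hnorm H x)\<^sup>2 * k $ j" for j
  proof -
    have A': "A j \<in> bounded_op H H" using A by (simp add: selfadjoint_op_iff)
    have "inner_prod H (A j (c \<odot> x)) (c \<odot> x) = (c * cnj c) * inner_prod H (A j x) x"
      using x(1) bounded_op_closed[OF A' x(1)]
      by (simp add: bounded_op_scale[OF A'] inner_prod_smult_left inner_prod_smult_right)
    then have "k $ j = 1 / (hnorm H x)\<^sup>2 * Re (inner_prod H (A j x) x)"
      unfolding c(2) k_def by simp
    then show ?thesis using nz by simp
  qed
  ultimately show ?thesis by (intro bexI[of _ k]) (simp_all add: vec_eq_iff)
qed

end

text \<open>A hyperplane strictly separating \<open>w\<close> from r K would, by symmetry, have both
  r e_i and - r e_i on the side of r K. So \<open>bound\<close> applies to the separating functional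
  with \<beta> = - b and contradicts g . w < b.\<close>

lemma mem_scaled_if_bounded_functionals:
  fixes K :: "(real ^ 'd::finite) set"
  assumes "compact K" "convex K" and sym: "uminus ` K = K" and "r \<ge> 0" and e: "\<And>i. i \<in> I \<Longrightarrow> e i \<in> K"
    and bound: "\<And>g \<beta>. \<forall>i\<in>I. \<bar>r * (g \<bullet> e i)\<bar> \<le> \<beta> \<Longrightarrow> \<bar>g \<bullet> w\<bar> \<le> \<beta>"
  shows "w \<in> (*\<^sub>R) r ` K"
proof (rule ccontr)
  assume "w \<notin> (*\<^sub>R) r ` K"
  moreover have "convex ((*\<^sub>R) r ` K)" using assms(2) by (rule convex_scaling)
  moreover have "closed ((*\<^sub>R) r ` K)"
    using assms(1) by (intro compact_imp_closed compact_scaling)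
  ultimately obtain g b where g: "g \<bullet> w < b" "\<forall>x\<in>(*\<^sub>R) r ` K. b < g \<bullet> x"
    using separating_hyperplane_closed_point by blast
  have "\<bar>r * (g \<bullet> e i)\<bar> \<le> - b" if "i \<in> I" for i
  proof -
    have "- e i \<in> K" using sym e[OF that] by (metis imageI)
    then have "b < g \<bullet> (r *\<^sub>R e i)" "b < g \<bullet> (r *\<^sub>R (- e i))" using g(2) e[OF that] by blast+
    then show ?thesis by simp
  qed
  then have "\<bar>g \<bullet> w\<bar> \<le> - b" using bound by blast
  with g(1) show False by simp
qed

theorem corollary4p6:
  fixes K :: "(real ^ 'd::finite) set"
    and H :: "'a hilbert"
    and A :: "'d \<Rightarrow> 'a \<Rightarrow> 'a"
  assumes "compact K" and "convex K" and "uminus ` K = K"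
    and "hilbert_space H"
    and "\<And>i. selfadjoint_op H (A i)"
    and "W1 H A \<subseteq> complex_vec ` K"
  shows "\<exists>(H2 :: (nat \<Rightarrow> 'a) hilbert) N.
    hilbert_space H2 \<and> normal_tuple H2 N \<and> is_dilation H A H2 N \<and>
    joint_spectrum H2 N \<subseteq> complex_vec ` ((*\<^sub>R) (real CARD('d)) ` K)"
proof -
  interpret hilbert_space H by fact
  \<comment> \<open>Natural numbers index the summands because the type of the dilation space is
    \<open>nat \<Rightarrow> 'a\<close>.\<close>
  define I where "I = {..<CARD('d)}"
  have I: "finite I" "I \<noteq> {}" "card I = CARD('d)" by (auto simp: I_def lessThan_empty_iff)
  let ?D = "direct_power I H" and ?w = "\<lambda>x. \<chi> j. Re (inner_prod H (A j x) x)"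
  have D: "hilbert_space ?D" by (rule hilbert_space_direct_power[OF I(1)])
  have w_zero: "?w \<zero>\<^bsub>H\<^esub> = 0"
  proof -
    have "A j \<zero>\<^bsub>H\<^esub> \<in> carrier H" for j
      using assms(5)[of j] by (auto simp: selfadjoint_op_iff intro: bounded_op_closed)
    then show ?thesis by (simp add: vec_eq_iff)
  qed
  show ?thesis
  proof (cases "K = {}")
    \<comment> \<open>With \<open>K\<close> empty, \<open>W1\<close> is empty, so \<open>H\<close>
      has no unit vector and is the zero space. The construction with e = f = 0 still yields a
      dilation, on a zero space with empty spectrum.\<close>
    case True
    have "x = \<zero>\<^bsub>H\<^esub>" if "x \<in> carrier H" for x
      using numerical_range_scaled[where A = A, OF assms(5,6) that] True by blast
    then have H: "carrier H = {\<zero>\<^bsub>H\<^esub>}" using M.zero_closed by blast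
    from direct_sum_dilation[where A = A and e = "\<lambda>i. 0" and f = "\<lambda>i. 0", OF I(1,2) assms(5)]
    obtain N where N: "normal_tuple ?D N" "is_dilation H A ?D N"
      using H w_zero by auto
    have "carrier ?D = {\<zero>\<^bsub>?D\<^esub>}" by (auto simp: H PiE_singleton)
    moreover have "N j \<in> bounded_op ?D ?D" for j
      using N(1) by (simp add: normal_tuple_def normal_op_def)
    ultimately have "joint_spectrum ?D N = {}" by (rule hilbert_space.joint_spectrum_trivial[OF D])
    with D N show ?thesis by blast
  next
    case False
    obtain e f :: "'d \<Rightarrow> real ^ 'd" where e: "\<And>i. e i \<in> K" and f: "\<And>i x. x \<in> K \<Longrightarrow> \<bar>f i \<bullet> x\<bar> \<le> 1"
      and ef: "\<And>x. x \<in> K \<Longrightarrow> (\<Sum>i\<in>UNIV. (f i \<bullet> x) *\<^sub>R e i) = x"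
      using auerbach_basis[OF assms(1) False] by blast
    \<comment> \<open>Transports the basis, indexed by the type \<open>'d\<close>, to the index set
      \<open>I\<close> of natural numbers.\<close>
    obtain h where h: "bij_betw h I (UNIV :: 'd set)"
      using finite_same_card_bij[OF I(1) finite_class.finite_UNIV I(3)] by blast
    \<comment> \<open>At the zero vector the form and the factor |x|^2 both vanish, so any point of
      the non-empty \<open>K\<close> serves.\<close>
    have w: "\<exists>k\<in>K. ?w x = (hnorm H x)\<^sup>2 *\<^sub>R k" if "x \<in> carrier H" for x
    proof (cases "x = \<zero>\<^bsub>H\<^esub>")
      case True
      then show ?thesis using False w_zero by auto
    qed (use numerical_range_scaled[where A = A, OF assms(5,6) that] in blast)
    have contr: "\<bar>f (h i) \<bullet> ?w x\<bar> \<le> (hnorm H x)\<^sup>2" if x: "x \<in> carrier H" for i x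
    proof -
      obtain k where "k \<in> K" "?w x = (hnorm H x)\<^sup>2 *\<^sub>R k" using w[OF x] by blast
      then show ?thesis
        using f[of k "h i"] mult_left_le[of "\<bar>f (h i) \<bullet> k\<bar>" "(hnorm H x)\<^sup>2"] by (simp add: abs_mult)
    qed
    have expand: "(\<Sum>i\<in>I. (f (h i) \<bullet> ?w x) *\<^sub>R e (h i)) = ?w x" if x: "x \<in> carrier H" for x
    proof -
      obtain k where k: "k \<in> K" "?w x = (hnorm H x)\<^sup>2 *\<^sub>R k" using w[OF x] by blast
      have "(\<Sum>i\<in>I. (f (h i) \<bullet> ?w x) *\<^sub>R e (h i)) = (\<Sum>i\<in>UNIV. (f i \<bullet> ?w x) *\<^sub>R e i)"
        by (rule sum.reindex_bij_betw[OF h])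
      also have "\<dots> = (hnorm H x)\<^sup>2 *\<^sub>R (\<Sum>i\<in>UNIV. (f i \<bullet> k) *\<^sub>R e i)"
        unfolding k(2) by (simp add: scaleR_sum_right)
      also have "\<dots> = ?w x" by (simp only: ef[OF k(1)] k(2))
      finally show ?thesis .
    qed
    from direct_sum_dilation[where A = A and e = "\<lambda>i. e (h i)" and f = "\<lambda>i. f (h i)",
        OF I(1,2) assms(5) contr expand]
    obtain N where N: "normal_tuple ?D N" "is_dilation H A ?D N"
      and spec: "\<forall>v\<in>joint_spectrum ?D N. \<exists>w. v = complex_vec w \<and>
        (\<forall>g \<beta>. (\<forall>i\<in>I. \<bar>real (card I) * (g \<bullet> e (h i))\<bar> \<le> \<beta>) \<longrightarrow> \<bar>g \<bullet> w\<bar> \<le> \<beta>)"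
      by auto
    have "joint_spectrum ?D N \<subseteq> complex_vec ` ((*\<^sub>R) (real CARD('d)) ` K)"
    proof
      fix v assume "v \<in> joint_spectrum ?D N"
      with spec obtain w where v: "v = complex_vec w"
        and w: "\<And>g \<beta>. \<forall>i\<in>I. \<bar>real CARD('d) * (g \<bullet> e (h i))\<bar> \<le> \<beta> \<Longrightarrow> \<bar>g \<bullet> w\<bar> \<le> \<beta>"
        unfolding I(3) by blast
      have "w \<in> (*\<^sub>R) (real CARD('d)) ` K"
        by (rule mem_scaled_if_bounded_functionals[OF assms(1-3) _ e w]) simp_all
      then show "v \<in> complex_vec ` ((*\<^sub>R) (real CARD('d)) ` K)" unfolding v by (rule imageI)
    qed
    with D N show ?thesis by blast
  qed
qed

end
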